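(* Let $(\mathcal{X},d)$ be a finite metric space with at least two points, $\mu\in\mathcal{M}_+(\mathcal{X})$, $t>0$, $s\in(0,1]$, and let $\hat\mu_{t,s}$ be the Poisson-model estimator. Then for every $p\ge1$, $C>0$, $q>1$ and $L\in\mathbb{N}$, $$\mathbb{E}\big[\mathrm{KR}_{p,C}(\hat\mu_{t,s},\mu)\big]\le \mathcal{E}^{\mathrm{Poi}}_{p,\mathcal{X}}(C,q,L)^{1/p}\cdot\begin{cases}\Big(2(1-s)\mathbb{M}(\mu)+\frac{s}{\sqrt t}\sum_{x\in\mathcal{X}}\sqrt{\mu(x)}\Big)^{1/p}, & \text{if } C\le\max\{2h_{q,L}(L),\min_{x\ne x'}d(x,x')\},\\[1ex] \Big(\frac{1}{st}\mathbb{M}(\mu)+\frac{1-s}{s}\sum_{x\in\mathcal{X}}\mu(x)^2\Big)^{1/(2p)}, & \text{otherwise,}\end{cases}$$ where $\mathcal{E}^{\mathrm{Poi}}_{p,\mathcal{X}}(C,q,L)$ is defined in the context. Moreover, for $p=1$ the bound remains valid when the factor $\frac{q}{q-1}$ is removed from $A_{q,1,L,\mathcal{X}}(l)$.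
   Context: $\mathcal{M}_+(\mathcal{X})$, $\mathbb{M}(\mu)=\sum_x\mu(x)$, sub-couplings $\Pi_\le(\mu,\nu)=\{\pi\ge0:\sum_{x'}\pi(x,x')\le\mu(x),\sum_x\pi(x,x')\le\nu(x')\}$ and $\mathrm{KR}_{p,C}(\mu,\nu)=\big(\min_{\pi\in\Pi_\le(\mu,\nu)}\sum_{x,x'}d^p(x,x')\pi(x,x')+C^p(\frac{\mathbb{M}(\mu)+\mathbb{M}(\nu)}{2}-\mathbb{M}(\pi))\big)^{1/p}$. Poisson model: independent $P_x\sim\mathrm{Poi}(t\mu(x))$ and independent $B_x\sim\mathrm{Ber}(s)$, $x\in\mathcal{X}$; $\hat\mu_{t,s}=\frac{1}{st}\sum_xB_xP_x\delta_x$. Height function: $h_{q,L}(k)=\frac{q^{1-k}-q^{-L}}{q-1}\mathrm{diam}(\mathcal{X})$. For $j=0,\dots,L$, $Q_j\subset\mathcal{X}$ is a $q^{-j}\mathrm{diam}(\mathcal{X})$-cover of $\mathcal{X}$ of minimal cardinality (a set $S$ with every point of $\mathcal{X}$ within distance $q^{-j}\mathrm{diam}(\mathcal{X})$ of $S$). Define $$A_{q,p,L,\mathcal{X}}(l)=\mathrm{diam}(\mathcal{X})^p2^{p-1}\Big(q^{-Lp}|\mathcal{X}|^{1/2}+\Big(\tfrac{q}{q-1}\Big)^p\sum_{j=l}^Lq^{p-jp}|Q_j|^{1/2}\Big).$$ The constant $\mathcal{E}^{\mathrm{Poi}}_{p,\mathcal{X}}(C,q,L)$ is: $\frac{C^p}{2}$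 if $C\le\max\{2h_{q,L}(L),\min_{x\ne x'}d(x,x')\}$; otherwise $\big(\frac{C^p}{2}-2^{p-1}\big(\frac{q-q^{-L}}{q-1}\mathrm{diam}(\mathcal{X})\big)^p\big)+A_{q,p,L,\mathcal{X}}(1)$ if $C\ge2h_{q,L}(0)$; and otherwise $A_{q,p,L,\mathcal{X}}(l)$ where $l\in\{1,\dots,L\}$ is such that $2h_{q,L}(l)\le C<2h_{q,L}(l-1)$. *)

theory Defs
  imports "HOL-Analysis.Analysis" "HOL-Probability.Probability"
begin

definition finite_metric :: "'a set \<Rightarrow> ('a \<Rightarrow> 'a \<Rightarrow> real) \<Rightarrow> bool" where
  "finite_metric X d \<longleftrightarrow> finite X \<and>
     (\<forall>x\<in>X. \<forall>y\<in>X. d x y \<ge> 0 \<and> (d x y = 0 \<longleftrightarrow> x = y) \<and> d x y = d y x) \<and>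
     (\<forall>x\<in>X. \<forall>y\<in>X. \<forall>z\<in>X. d x z \<le> d x y + d y z)"

definition diam_fm :: "'a set \<Rightarrow> ('a \<Rightarrow> 'a \<Rightarrow> real) \<Rightarrow> real" where
  "diam_fm X d = Max {d x y | x y. x \<in> X \<and> y \<in> X}"

definition min_dist :: "'a set \<Rightarrow> ('a \<Rightarrow> 'a \<Rightarrow> real) \<Rightarrow> real" where
  "min_dist X d = Min {d x y | x y. x \<in> X \<and> y \<in> X \<and> x \<noteq> y}"

definition mass :: "'a set \<Rightarrow> ('a \<Rightarrow> real) \<Rightarrow> real" where
  "mass X \<mu> = (\<Sum>x\<in>X. \<mu> x)"

definition subcouplings :: "'a set \<Rightarrow> ('a \<Rightarrow> real) \<Rightarrow> ('a \<Rightarrow> real) \<Rightarrow> ('a \<Rightarrow> 'a \<Rightarrow> real) set" where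
  "subcouplings X \<mu> \<nu> = {\<pi>. (\<forall>x\<in>X. \<forall>x'\<in>X. \<pi> x x' \<ge> 0) \<and>
       (\<forall>x\<in>X. (\<Sum>x'\<in>X. \<pi> x x') \<le> \<mu> x) \<and> (\<forall>x'\<in>X. (\<Sum>x\<in>X. \<pi> x x') \<le> \<nu> x')}"

text \<open>Kantorovich--Rubinstein distance KR_{p,C}; the minimum is written as an infimum.\<close>
definition KR :: "'a set \<Rightarrow> ('a \<Rightarrow> 'a \<Rightarrow> real) \<Rightarrow> real \<Rightarrow> real \<Rightarrow> ('a \<Rightarrow> real) \<Rightarrow> ('a \<Rightarrow> real) \<Rightarrow> real" where
  "KR X d p C \<mu> \<nu> =
     (Inf ((\<lambda>\<pi>. (\<Sum>x\<in>X. \<Sum>x'\<in>X. d x x' powr p * \<pi> x x')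
              + C powr p * ((mass X \<mu> + mass X \<nu>) / 2 - (\<Sum>x\<in>X. \<Sum>x'\<in>X. \<pi> x x')))
           ` subcouplings X \<mu> \<nu>)) powr (1 / p)"

definition poi :: "real \<Rightarrow> nat pmf" where
  "poi r = (if r = 0 then return_pmf 0 else poisson_pmf r)"

definition poisson_model :: "'a set \<Rightarrow> ('a \<Rightarrow> real) \<Rightarrow> real \<Rightarrow> real \<Rightarrow> ('a \<Rightarrow> nat \<times> bool) pmf" where
  "poisson_model X \<mu> t s = Pi_pmf X (0, False) (\<lambda>x. pair_pmf (poi (t * \<mu> x)) (bernoulli_pmf s))"

definition estimator :: "real \<Rightarrow> real \<Rightarrow> ('a \<Rightarrow> nat \<times> bool) \<Rightarrow> 'a \<Rightarrow> real" where
  "estimator t s \<omega> x = (if snd (\<omega> x) then real (fst (\<omega> x)) else 0) / (s * t)"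

definition height :: "'a set \<Rightarrow> ('a \<Rightarrow> 'a \<Rightarrow> real) \<Rightarrow> real \<Rightarrow> nat \<Rightarrow> nat \<Rightarrow> real" where
  "height X d q L k = (q powr (1 - real k) - q powr (- real L)) / (q - 1) * diam_fm X d"

definition cover_number :: "'a set \<Rightarrow> ('a \<Rightarrow> 'a \<Rightarrow> real) \<Rightarrow> real \<Rightarrow> nat" where
  "cover_number X d r = Min {card S | S. S \<subseteq> X \<and> (\<forall>x\<in>X. \<exists>y\<in>S. d x y \<le> r)}"

text \<open>A_{q,p,L,X}(l), with the factor q/(q-1) replaced by a parameter \<kappa>.\<close>
definition A_const :: "'a set \<Rightarrow> ('a \<Rightarrow> 'a \<Rightarrow> real) \<Rightarrow> real \<Rightarrow> real \<Rightarrow> real \<Rightarrow> nat \<Rightarrow> nat \<Rightarrow> real" where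
  "A_const X d \<kappa> q p L l = diam_fm X d powr p * 2 powr (p - 1) *
     (q powr (- real L * p) * sqrt (real (card X)) +
      \<kappa> powr p * (\<Sum>j=l..L. q powr (p - real j * p) *
                     sqrt (real (cover_number X d (q powr (- real j) * diam_fm X d)))))"

text \<open>The constant \<E>^Poi_{p,X}(C,q,L), with the factor q/(q-1) in A replaced by \<kappa>.\<close>
definition E_Poi_gen :: "'a set \<Rightarrow> ('a \<Rightarrow> 'a \<Rightarrow> real) \<Rightarrow> real \<Rightarrow> real \<Rightarrow> real \<Rightarrow> real \<Rightarrow> nat \<Rightarrow> real" where
  "E_Poi_gen X d \<kappa> p C q L =
     (if C \<le> max (2 * height X d q L L) (min_dist X d) then C powr p / 2
      else if C \<ge> 2 * height X d q L 0 then
        (C powr p / 2 - 2 powr (p - 1) * ((q - q powr (- real L)) / (q - 1) * diam_fm X d) powr p)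
        + A_const X d \<kappa> q p L 1
      else A_const X d \<kappa> q p L
             (THE l. l \<in> {1..L} \<and> 2 * height X d q L l \<le> C \<and> C < 2 * height X d q L (l - 1)))"

definition E_Poi :: "'a set \<Rightarrow> ('a \<Rightarrow> 'a \<Rightarrow> real) \<Rightarrow> real \<Rightarrow> real \<Rightarrow> real \<Rightarrow> nat \<Rightarrow> real" where
  "E_Poi X d p C q L = E_Poi_gen X d (q / (q - 1)) p C q L"

definition poi_bound :: "'a set \<Rightarrow> ('a \<Rightarrow> 'a \<Rightarrow> real) \<Rightarrow> ('a \<Rightarrow> real) \<Rightarrow> real \<Rightarrow> real \<Rightarrow> real \<Rightarrow> real \<Rightarrow> real \<Rightarrow> nat \<Rightarrow> real \<Rightarrow> real" where
  "poi_bound X d \<mu> t s p C q L E =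
     E powr (1 / p) *
     (if C \<le> max (2 * height X d q L L) (min_dist X d)
      then (2 * (1 - s) * mass X \<mu> + s / sqrt t * (\<Sum>x\<in>X. sqrt (\<mu> x))) powr (1 / p)
      else (mass X \<mu> / (s * t) + (1 - s) / s * (\<Sum>x\<in>X. (\<mu> x)\<^sup>2)) powr (1 / (2 * p)))"

end

theory Submission
  imports Defs
begin

text \<open>
  Composing nearest-point maps of the covers \<open>Q\<^sub>j\<close> turns \<open>X\<close> into the leaves of a tree in which two
  points sharing their level-\<open>k\<close> ancestor have distance at most \<open>2 h(k)\<close>. Matching as much mass as
  possible inside the level-\<open>k\<close> clusters, for \<open>k\<close> from \<open>L + 1\<close> down to a stopping level, leaves half of
  the level-\<open>k\<close> imbalance \<open>\<Sum>\<^sub>v \<bar>\<mu>(v) - \<nu>(v)\<bar>\<close> unmatched; summation by parts bounds \<open>KR\<^sup>p\<close> by a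
  combination of these imbalances. In the Poisson model the expected imbalance over \<open>n\<close> clusters is at
  most \<open>\<surd>n\<close> times the root of the total variance, and Jensen's inequality removes the power \<open>1/p\<close>.
\<close>

subsection \<open>Multiscale bounds for the Kantorovich--Rubinstein distance\<close>

text \<open>The l1 distance between the images of \<open>\<mu>\<close> and \<open>\<nu>\<close>
  under \<open>f\<close>. Half of it is the average mass left over when as much as possible is
  matched within the fibres of \<open>f\<close>.\<close>

definition imbalance :: "'a set \<Rightarrow> ('a \<Rightarrow> 'b) \<Rightarrow> ('a \<Rightarrow> real) \<Rightarrow> ('a \<Rightarrow> real) \<Rightarrow> real" where
  "imbalance X f \<mu> \<nu> = (\<Sum>v\<in>f ` X. \<bar>\<Sum>x | x \<in> X \<and> f x = v. \<mu> x - \<nu> x\<bar>)"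

lemma imbalance_nonneg: "0 \<le> imbalance X f \<mu> \<nu>"
  unfolding imbalance_def by (intro sum_nonneg) auto

text \<open>Inside each fibre the residual marginals are coupled by their product, scaled by the larger of the
  two residual masses; a fibre without residual mass gives \<open>0 / 0 = 0\<close>.\<close>

lemma subcoupling_extend:
  fixes f :: "'a \<Rightarrow> 'b"
  assumes fin: "finite X" and \<pi>: "\<pi> \<in> subcouplings X \<mu> \<nu>"
    and supp: "\<And>x y. x \<in> X \<Longrightarrow> y \<in> X \<Longrightarrow> \<pi> x y \<noteq> 0 \<Longrightarrow> f x = f y"
  obtains \<pi>' where "\<pi>' \<in> subcouplings X \<mu> \<nu>"
    and "\<And>x y. x \<in> X \<Longrightarrow> y \<in> X \<Longrightarrow> \<pi>' x y \<noteq> 0 \<Longrightarrow> f x = f y"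
    and "\<And>x y. x \<in> X \<Longrightarrow> y \<in> X \<Longrightarrow> \<pi> x y \<le> \<pi>' x y"
    and "(mass X \<mu> + mass X \<nu>) / 2 - (\<Sum>x\<in>X. \<Sum>y\<in>X. \<pi>' x y) = imbalance X f \<mu> \<nu> / 2"
proof -
  define V where "V v = {x. x \<in> X \<and> f x = v}" for v
  define a where "a x = \<mu> x - (\<Sum>y\<in>X. \<pi> x y)" for x
  define b where "b y = \<nu> y - (\<Sum>x\<in>X. \<pi> x y)" for y
  define A where "A v = sum a (V v)" for v
  define B where "B v = sum b (V v)" for v
  define \<rho> where "\<rho> x y = (if f x = f y then a x * b y / max (A (f x)) (B (f x)) else 0)" for x y
  have finV: "finite (V v)" for v using fin by (simp add: V_def)
  have a0: "0 \<le> a x" if "x \<in> X" for x using \<pi> that by (auto simp: a_def subcouplings_def)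
  have b0: "0 \<le> b x" if "x \<in> X" for x using \<pi> that by (auto simp: b_def subcouplings_def)
  have A0: "0 \<le> A v" for v unfolding A_def by (intro sum_nonneg a0) (auto simp: V_def)
  have B0: "0 \<le> B v" for v unfolding B_def by (intro sum_nonneg b0) (auto simp: V_def)
  have fibre: "(\<Sum>y\<in>X. if f y = v then g y else 0) = sum g (V v)" for g :: "'a \<Rightarrow> real" and v
    using fin by (simp add: V_def sum.If_cases Int_def)
  have row: "(\<Sum>y\<in>X. \<rho> x y) = a x * B (f x) / max (A (f x)) (B (f x))" for x
  proof -
    have "(\<Sum>y\<in>X. \<rho> x y) = (\<Sum>y\<in>X. if f y = f x then a x * b y / max (A (f x)) (B (f x)) else 0)"
      by (intro sum.cong) (auto simp: \<rho>_def)
    then show ?thesis by (simp add: fibre B_def sum_distrib_left sum_divide_distrib)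
  qed
  have col: "(\<Sum>x\<in>X. \<rho> x y) = b y * A (f y) / max (A (f y)) (B (f y))" for y
  proof -
    have "(\<Sum>x\<in>X. \<rho> x y) = (\<Sum>x\<in>X. if f x = f y then b y * a x / max (A (f y)) (B (f y)) else 0)"
      by (intro sum.cong) (auto simp: \<rho>_def)
    then show ?thesis by (simp add: fibre A_def sum_distrib_left sum_divide_distrib)
  qed
  have frac: "u * r / max r' r \<le> u" "u * r / max r r' \<le> u" if "0 \<le> u" "0 \<le> r" for u r r' :: real
    using that by (auto simp: divide_simps max_def intro: mult_left_mono)
  have \<rho>0: "0 \<le> \<rho> x y" if "x \<in> X" "y \<in> X" for x y
    using a0[OF that(1)] b0[OF that(2)] A0[of "f x"] by (auto simp: \<rho>_def le_max_iff_disj)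
  have total: "(\<Sum>x\<in>X. \<Sum>y\<in>X. \<rho> x y) = (\<Sum>v\<in>f ` X. min (A v) (B v))"
  proof -
    have "(\<Sum>x\<in>X. \<Sum>y\<in>X. \<rho> x y) = (\<Sum>v\<in>f ` X. \<Sum>x\<in>V v. a x * B (f x) / max (A (f x)) (B (f x)))"
      unfolding row V_def by (rule sum.image_gen[OF fin])
    also have "\<dots> = (\<Sum>v\<in>f ` X. A v * B v / max (A v) (B v))"
      by (intro sum.cong) (auto simp: V_def A_def sum_distrib_right sum_divide_distrib)
    also have "\<dots> = (\<Sum>v\<in>f ` X. min (A v) (B v))"
    proof (intro sum.cong refl)
      fix v show "A v * B v / max (A v) (B v) = min (A v) (B v)"
        using A0[of v] B0[of v] by (auto simp: max_def min_def)
    qed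
    finally show ?thesis .
  qed
  \<comment> \<open>Since \<open>\<pi>\<close> only charges pairs inside one fibre, the mass it
    takes from \<open>V v\<close> on one side equals the mass it takes on the other, so it cancels
    from the residual imbalance.\<close>
  have diff: "A v - B v = (\<Sum>x\<in>V v. \<mu> x - \<nu> x)" for v
  proof -
    have "(\<Sum>x\<in>V v. \<Sum>y\<in>X. \<pi> x y) = (\<Sum>x\<in>V v. \<Sum>y\<in>V v. \<pi> x y)"
      by (intro sum.cong refl sum.mono_neutral_right fin) (use supp in \<open>auto simp: V_def\<close>)
    also have "\<dots> = (\<Sum>y\<in>V v. \<Sum>x\<in>V v. \<pi> x y)" by (rule sum.swap)
    also have "\<dots> = (\<Sum>y\<in>V v. \<Sum>x\<in>X. \<pi> x y)"
      by (intro sum.cong refl sum.mono_neutral_left fin) (use supp in \<open>auto simp: V_def\<close>)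
    finally show ?thesis by (simp add: A_def B_def a_def b_def sum_subtractf)
  qed
  have sumA: "(\<Sum>v\<in>f ` X. A v) = mass X \<mu> - (\<Sum>x\<in>X. \<Sum>y\<in>X. \<pi> x y)"
    unfolding A_def V_def sum.image_gen[OF fin, symmetric] by (simp add: a_def mass_def sum_subtractf)
  have sumB: "(\<Sum>v\<in>f ` X. B v) = mass X \<nu> - (\<Sum>x\<in>X. \<Sum>y\<in>X. \<pi> x y)"
    unfolding B_def V_def sum.image_gen[OF fin, symmetric]
    by (simp add: b_def mass_def sum_subtractf sum.swap[of "\<lambda>x y. \<pi> y x"])
  have "(\<Sum>v\<in>f ` X. min (A v) (B v)) = (\<Sum>v\<in>f ` X. (A v + B v) / 2 - \<bar>A v - B v\<bar> / 2)"
    by (intro sum.cong refl) (auto simp: min_def field_simps)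
  also have "\<dots> = (mass X \<mu> + mass X \<nu>) / 2 - (\<Sum>x\<in>X. \<Sum>y\<in>X. \<pi> x y) - imbalance X f \<mu> \<nu> / 2"
    unfolding imbalance_def V_def[symmetric] diff
    by (simp only: sum_subtractf sum.distrib sum_divide_distrib[symmetric] sumA sumB) (simp add: field_simps)
  finally have mass: "(\<Sum>x\<in>X. \<Sum>y\<in>X. \<rho> x y)
      = (mass X \<mu> + mass X \<nu>) / 2 - (\<Sum>x\<in>X. \<Sum>y\<in>X. \<pi> x y) - imbalance X f \<mu> \<nu> / 2"
    using total by simp
  show ?thesis
  proof (rule that[of "\<lambda>x y. \<pi> x y + \<rho> x y"])
    show "(\<lambda>x y. \<pi> x y + \<rho> x y) \<in> subcouplings X \<mu> \<nu>"
      using \<pi> \<rho>0 frac[OF a0 B0, of _ "f _" "A (f _)"] frac[OF b0 A0, of _ "f _" "B (f _)"]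
      by (auto simp: subcouplings_def sum.distrib row col a_def b_def le_diff_eq add.commute)
    show "f x = f y" if "x \<in> X" "y \<in> X" "\<pi> x y + \<rho> x y \<noteq> 0" for x y
      using supp[OF that(1,2)] that(3) by (auto simp: \<rho>_def split: if_splits)
    show "\<pi> x y \<le> \<pi> x y + \<rho> x y" if "x \<in> X" "y \<in> X" for x y
      using \<rho>0[OF that] by simp
    show "(mass X \<mu> + mass X \<nu>) / 2 - (\<Sum>x\<in>X. \<Sum>y\<in>X. \<pi> x y + \<rho> x y) = imbalance X f \<mu> \<nu> / 2"
      by (simp add: sum.distrib mass)
  qed
qed

text \<open>Downward induction from the leaf level \<open>N\<close>. Passing from level
  \<open>k + 1\<close> to \<open>k\<close> matches extra mass equal to half the drop in imbalance,
  at unit price at most \<open>(2 * H k) powr p\<close>, which is twice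
  \<open>2 powr (p - 1) * H k powr p\<close>. The imbalance term on the left of the cost bound acts
  as a potential: with it, each step adds exactly one summand on the right.\<close>

lemma multiscale_subcoupling:
  fixes F :: "nat \<Rightarrow> 'a \<Rightarrow> 'b" and d :: "'a \<Rightarrow> 'a \<Rightarrow> real" and H :: "nat \<Rightarrow> real"
  assumes fin: "finite X" and \<mu>0: "\<And>x. x \<in> X \<Longrightarrow> 0 \<le> \<mu> x" and \<nu>0: "\<And>x. x \<in> X \<Longrightarrow> 0 \<le> \<nu> x"
    and d0: "\<And>x y. x \<in> X \<Longrightarrow> y \<in> X \<Longrightarrow> 0 \<le> d x y"
    and nested: "\<And>k x y. k < N \<Longrightarrow> x \<in> X \<Longrightarrow> y \<in> X \<Longrightarrow> F (Suc k) x = F (Suc k) y \<Longrightarrow> F k x = F k y"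
    and H0: "\<And>k. k \<le> N \<Longrightarrow> 0 \<le> H k" and HN: "H N = 0"
    and dH: "\<And>k x y. k \<le> N \<Longrightarrow> x \<in> X \<Longrightarrow> y \<in> X \<Longrightarrow> F k x = F k y \<Longrightarrow> d x y \<le> 2 * H k"
    and p: "0 \<le> p" and "k \<le> N"
  shows "\<exists>\<pi> \<in> subcouplings X \<mu> \<nu>.
      (\<forall>x\<in>X. \<forall>y\<in>X. \<pi> x y \<noteq> 0 \<longrightarrow> F k x = F k y) \<and>
      (mass X \<mu> + mass X \<nu>) / 2 - (\<Sum>x\<in>X. \<Sum>y\<in>X. \<pi> x y) = imbalance X (F k) \<mu> \<nu> / 2 \<and>
      (\<Sum>x\<in>X. \<Sum>y\<in>X. d x y powr p * \<pi> x y) + 2 powr (p - 1) * H k powr p * imbalance X (F k) \<mu> \<nu>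
        \<le> 2 powr (p - 1) * (\<Sum>j=Suc k..N. (H (j - 1) powr p - H j powr p) * imbalance X (F j) \<mu> \<nu>)"
  using \<open>k \<le> N\<close>
proof (induction rule: inc_induct)
  case base
  have z: "(\<lambda>x y. 0) \<in> subcouplings X \<mu> \<nu>" using \<mu>0 \<nu>0 by (simp add: subcouplings_def)
  obtain \<pi> where \<pi>: "\<pi> \<in> subcouplings X \<mu> \<nu>"
    and s: "\<And>x y. x \<in> X \<Longrightarrow> y \<in> X \<Longrightarrow> \<pi> x y \<noteq> 0 \<Longrightarrow> F N x = F N y"
    and m: "(mass X \<mu> + mass X \<nu>) / 2 - (\<Sum>x\<in>X. \<Sum>y\<in>X. \<pi> x y) = imbalance X (F N) \<mu> \<nu> / 2"
    by (rule subcoupling_extend[OF fin z, of "F N"]) (simp, rule that)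
  \<comment> \<open>Leaf clusters have diameter zero because \<open>H N = 0\<close>, and
    \<open>0 powr p = 0\<close> for every \<open>p\<close>, so matching there is free.\<close>
  have "d x y powr p * \<pi> x y = 0" if "x \<in> X" "y \<in> X" for x y
    using s[OF that] dH[OF order_refl that] d0[OF that] HN by force
  then have "(\<Sum>x\<in>X. \<Sum>y\<in>X. d x y powr p * \<pi> x y) = 0"
    by (intro sum.neutral ballI)
  then show ?case using \<pi> s m HN by (intro bexI[of _ \<pi>]) auto
next
  case (step n)
  then obtain \<pi> where \<pi>: "\<pi> \<in> subcouplings X \<mu> \<nu>"
    and s: "\<And>x y. x \<in> X \<Longrightarrow> y \<in> X \<Longrightarrow> \<pi> x y \<noteq> 0 \<Longrightarrow> F (Suc n) x = F (Suc n) y"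
    and m: "(mass X \<mu> + mass X \<nu>) / 2 - (\<Sum>x\<in>X. \<Sum>y\<in>X. \<pi> x y) = imbalance X (F (Suc n)) \<mu> \<nu> / 2"
    and c: "(\<Sum>x\<in>X. \<Sum>y\<in>X. d x y powr p * \<pi> x y)
          + 2 powr (p - 1) * H (Suc n) powr p * imbalance X (F (Suc n)) \<mu> \<nu>
        \<le> 2 powr (p - 1) * (\<Sum>j=Suc (Suc n)..N. (H (j - 1) powr p - H j powr p) * imbalance X (F j) \<mu> \<nu>)"
    by blast
  have sn: "\<And>x y. x \<in> X \<Longrightarrow> y \<in> X \<Longrightarrow> \<pi> x y \<noteq> 0 \<Longrightarrow> F n x = F n y"
    using s nested step.hyps by blast
  obtain \<pi>' where \<pi>': "\<pi>' \<in> subcouplings X \<mu> \<nu>"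
    and s': "\<And>x y. x \<in> X \<Longrightarrow> y \<in> X \<Longrightarrow> \<pi>' x y \<noteq> 0 \<Longrightarrow> F n x = F n y"
    and le: "\<And>x y. x \<in> X \<Longrightarrow> y \<in> X \<Longrightarrow> \<pi> x y \<le> \<pi>' x y"
    and m': "(mass X \<mu> + mass X \<nu>) / 2 - (\<Sum>x\<in>X. \<Sum>y\<in>X. \<pi>' x y) = imbalance X (F n) \<mu> \<nu> / 2"
    by (rule subcoupling_extend[OF fin \<pi>, of "F n"]) (erule (2) sn, rule that)
  define D where "D = (2 * H n) powr p"
  define E where "E = 2 powr (p - 1) * H n powr p"
  have D: "D = 2 * (2 powr (p - 1) * H n powr p)"
    using H0[of n] step.hyps by (simp add: D_def powr_mult powr_diff)
  \<comment> \<open>Mass already matched keeps its price; only the added mass is charged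
    \<open>D\<close>. Where mass has been added, \<open>\<pi>'\<close> is nonzero, so the two points
    share their level-\<open>n\<close> cluster.\<close>
  have pt: "d x y powr p * \<pi>' x y \<le> d x y powr p * \<pi> x y + D * (\<pi>' x y - \<pi> x y)"
    if xy: "x \<in> X" "y \<in> X" for x y
  proof (cases "\<pi>' x y = \<pi> x y")
    case False
    have "0 \<le> \<pi> x y" using \<pi> xy by (auto simp: subcouplings_def)
    with False le[OF xy] have "\<pi>' x y \<noteq> 0" by auto
    then have "d x y \<le> 2 * H n" using s' dH xy step.hyps by (meson less_imp_le)
    then have "d x y powr p \<le> D" unfolding D_def using d0[OF xy] p by (intro powr_mono2) auto
    then have "d x y powr p * (\<pi>' x y - \<pi> x y) \<le> D * (\<pi>' x y - \<pi> x y)"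
      using le[OF xy] by (intro mult_right_mono) auto
    then show ?thesis by (simp add: algebra_simps)
  qed simp
  have "(\<Sum>x\<in>X. \<Sum>y\<in>X. d x y powr p * \<pi>' x y)
      \<le> (\<Sum>x\<in>X. \<Sum>y\<in>X. d x y powr p * \<pi> x y + D * (\<pi>' x y - \<pi> x y))"
    by (intro sum_mono pt)
  also have "\<dots> = (\<Sum>x\<in>X. \<Sum>y\<in>X. d x y powr p * \<pi> x y)
      + D * ((\<Sum>x\<in>X. \<Sum>y\<in>X. \<pi>' x y) - (\<Sum>x\<in>X. \<Sum>y\<in>X. \<pi> x y))"
    by (simp add: sum.distrib sum_subtractf sum_distrib_left[symmetric])
  also have "(\<Sum>x\<in>X. \<Sum>y\<in>X. \<pi>' x y) - (\<Sum>x\<in>X. \<Sum>y\<in>X. \<pi> x y)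
      = (imbalance X (F (Suc n)) \<mu> \<nu> - imbalance X (F n) \<mu> \<nu>) / 2"
    using m m' by (simp add: field_simps)
  finally have c': "(\<Sum>x\<in>X. \<Sum>y\<in>X. d x y powr p * \<pi>' x y)
      + 2 powr (p - 1) * H n powr p * imbalance X (F n) \<mu> \<nu>
      \<le> (\<Sum>x\<in>X. \<Sum>y\<in>X. d x y powr p * \<pi> x y)
        + 2 powr (p - 1) * H n powr p * imbalance X (F (Suc n)) \<mu> \<nu>"
    unfolding D by (simp only: E_def[symmetric]) (simp add: field_simps)
  have "{Suc n..N} = insert (Suc n) {Suc (Suc n)..N}" using step.hyps by auto
  then have "2 powr (p - 1) * (\<Sum>j=Suc n..N. (H (j - 1) powr p - H j powr p) * imbalance X (F j) \<mu> \<nu>)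
     = 2 powr (p - 1) * H n powr p * imbalance X (F (Suc n)) \<mu> \<nu>
       - 2 powr (p - 1) * H (Suc n) powr p * imbalance X (F (Suc n)) \<mu> \<nu>
       + 2 powr (p - 1) * (\<Sum>j=Suc (Suc n)..N. (H (j - 1) powr p - H j powr p) * imbalance X (F j) \<mu> \<nu>)"
    by (simp add: distrib_left left_diff_distrib right_diff_distrib mult.assoc)
  then have "(\<Sum>x\<in>X. \<Sum>y\<in>X. d x y powr p * \<pi>' x y) + 2 powr (p - 1) * H n powr p * imbalance X (F n) \<mu> \<nu>
        \<le> 2 powr (p - 1) * (\<Sum>j=Suc n..N. (H (j - 1) powr p - H j powr p) * imbalance X (F j) \<mu> \<nu>)"
    using c c' by linarith
  then show ?case using \<pi>' s' m' by blast
qed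

text \<open>The sub-coupling stopped at level \<open>k\<close> is a competitor in the infimum. Its
  unmatched mass is half the level-\<open>k\<close> imbalance and costs \<open>C powr p\<close> per
  unit; the potential term of the induction is subtracted from this price.\<close>

lemma KR_le_multiscale:
  fixes F :: "nat \<Rightarrow> 'a \<Rightarrow> 'b" and d :: "'a \<Rightarrow> 'a \<Rightarrow> real" and H :: "nat \<Rightarrow> real"
  assumes fin: "finite X" and \<mu>0: "\<And>x. x \<in> X \<Longrightarrow> 0 \<le> \<mu> x" and \<nu>0: "\<And>x. x \<in> X \<Longrightarrow> 0 \<le> \<nu> x"
    and d0: "\<And>x y. x \<in> X \<Longrightarrow> y \<in> X \<Longrightarrow> 0 \<le> d x y"
    and nested: "\<And>k x y. k < N \<Longrightarrow> x \<in> X \<Longrightarrow> y \<in> X \<Longrightarrow> F (Suc k) x = F (Suc k) y \<Longrightarrow> F k x = F k y"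
    and H0: "\<And>k. k \<le> N \<Longrightarrow> 0 \<le> H k" and HN: "H N = 0"
    and dH: "\<And>k x y. k \<le> N \<Longrightarrow> x \<in> X \<Longrightarrow> y \<in> X \<Longrightarrow> F k x = F k y \<Longrightarrow> d x y \<le> 2 * H k"
    and p: "0 \<le> p" and "k \<le> N"
  shows "KR X d p C \<mu> \<nu> \<le>
    ((C powr p / 2 - 2 powr (p - 1) * H k powr p) * imbalance X (F k) \<mu> \<nu>
      + 2 powr (p - 1) * (\<Sum>j=Suc k..N. (H (j - 1) powr p - H j powr p) * imbalance X (F j) \<mu> \<nu>)) powr (1 / p)"
proof -
  define cost where "cost \<pi> = (\<Sum>x\<in>X. \<Sum>x'\<in>X. d x x' powr p * \<pi> x x')
     + C powr p * ((mass X \<mu> + mass X \<nu>) / 2 - (\<Sum>x\<in>X. \<Sum>x'\<in>X. \<pi> x x'))" for \<pi>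
  \<comment> \<open>The mass of a sub-coupling is at most that of either marginal, hence at most
    their mean. The lower bound makes the infimum meaningful and nonnegative, as monotonicity of the
    root requires.\<close>
  have cost0: "0 \<le> cost \<pi>" if "\<pi> \<in> subcouplings X \<mu> \<nu>" for \<pi>
  proof -
    have "(\<Sum>x\<in>X. \<Sum>y\<in>X. \<pi> x y) \<le> mass X \<mu>"
      using that by (auto simp: subcouplings_def mass_def intro!: sum_mono)
    moreover have "(\<Sum>y\<in>X. \<Sum>x\<in>X. \<pi> x y) \<le> mass X \<nu>"
      using that by (auto simp: subcouplings_def mass_def intro!: sum_mono)
    moreover have "(\<Sum>y\<in>X. \<Sum>x\<in>X. \<pi> x y) = (\<Sum>x\<in>X. \<Sum>y\<in>X. \<pi> x y)" by (rule sum.swap)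
    ultimately have "0 \<le> (mass X \<mu> + mass X \<nu>) / 2 - (\<Sum>x\<in>X. \<Sum>y\<in>X. \<pi> x y)" by simp
    moreover have "0 \<le> (\<Sum>x\<in>X. \<Sum>y\<in>X. d x y powr p * \<pi> x y)"
      using that by (intro sum_nonneg mult_nonneg_nonneg) (auto simp: subcouplings_def)
    ultimately show ?thesis by (simp add: cost_def)
  qed
  obtain \<pi> where \<pi>: "\<pi> \<in> subcouplings X \<mu> \<nu>"
    and m: "(mass X \<mu> + mass X \<nu>) / 2 - (\<Sum>x\<in>X. \<Sum>y\<in>X. \<pi> x y) = imbalance X (F k) \<mu> \<nu> / 2"
    and c: "(\<Sum>x\<in>X. \<Sum>y\<in>X. d x y powr p * \<pi> x y) + 2 powr (p - 1) * H k powr p * imbalance X (F k) \<mu> \<nu>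
        \<le> 2 powr (p - 1) * (\<Sum>j=Suc k..N. (H (j - 1) powr p - H j powr p) * imbalance X (F j) \<mu> \<nu>)"
    using multiscale_subcoupling[of X \<mu> \<nu> d N F H p k, OF assms] by blast
  have "Inf (cost ` subcouplings X \<mu> \<nu>) \<le> cost \<pi>"
    using cost0 \<pi> by (intro cInf_lower bdd_belowI[of _ 0]) auto
  also have "cost \<pi> \<le> (C powr p / 2 - 2 powr (p - 1) * H k powr p) * imbalance X (F k) \<mu> \<nu>
      + 2 powr (p - 1) * (\<Sum>j=Suc k..N. (H (j - 1) powr p - H j powr p) * imbalance X (F j) \<mu> \<nu>)"
    using c unfolding cost_def m by (simp add: algebra_simps)
  finally show ?thesis
    unfolding KR_def cost_def[symmetric]
    using cost0 \<pi> p by (intro powr_mono2 cInf_greatest) auto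
qed

subsection \<open>Nested partitions from covers\<close>

lemma cover_number_attained:
  assumes "finite_metric X d" "0 \<le> r"
  obtains S where "S \<subseteq> X" "\<forall>x\<in>X. \<exists>y\<in>S. d x y \<le> r" "card S = cover_number X d r"
proof -
  let ?K = "{card S | S. S \<subseteq> X \<and> (\<forall>x\<in>X. \<exists>y\<in>S. d x y \<le> r)}"
  have "finite X" using assms by (simp add: finite_metric_def)
  then have "finite ?K" by (auto simp: finite_image_set)
  moreover have "\<forall>x\<in>X. d x x \<le> r" using assms unfolding finite_metric_def by metis
  then have "card X \<in> ?K" by blast
  ultimately have "cover_number X d r \<in> ?K" unfolding cover_number_def by (intro Min_in) auto
  with that show ?thesis by auto
qed

lemma cover_number_le:
  assumes "finite_metric X d" "S \<subseteq> X" "\<forall>x\<in>X. \<exists>y\<in>S. d x y \<le> r"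
  shows "cover_number X d r \<le> card S"
proof -
  let ?K = "{card S | S. S \<subseteq> X \<and> (\<forall>x\<in>X. \<exists>y\<in>S. d x y \<le> r)}"
  have "finite X" using assms by (simp add: finite_metric_def)
  then have "finite ?K" by (auto simp: finite_image_set)
  then show ?thesis unfolding cover_number_def using assms by (intro Min_le) auto
qed

text \<open>The covers need not be nested: the map to level \<open>k\<close> sends the level-\<open>(k+1)\<close> image of a point
  (rather than the point itself) to a nearby centre, and this makes the fibres nested.\<close>

lemma nested_covers:
  fixes d :: "'a \<Rightarrow> 'a \<Rightarrow> real" and R :: "nat \<Rightarrow> real"
  assumes fm: "finite_metric X d" and R0: "\<And>k. 0 \<le> R k"
    and HN: "H N = 0" and HS: "\<And>k. k < N \<Longrightarrow> H k = R k + H (Suc k)"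
  obtains F where "\<And>x. F N x = x"
    and "\<And>k x y. k < N \<Longrightarrow> F (Suc k) x = F (Suc k) y \<Longrightarrow> F k x = F k y"
    and "\<And>k. k < N \<Longrightarrow> card (F k ` X) \<le> cover_number X d (R k)"
    and "\<And>k x y. k \<le> N \<Longrightarrow> x \<in> X \<Longrightarrow> y \<in> X \<Longrightarrow> F k x = F k y \<Longrightarrow> d x y \<le> 2 * H k"
proof -
  have fin: "finite X" and refl: "\<And>x. x \<in> X \<Longrightarrow> d x x = 0"
    and sym: "\<And>x y. x \<in> X \<Longrightarrow> y \<in> X \<Longrightarrow> d x y = d y x"
    and tri: "\<And>x y z. x \<in> X \<Longrightarrow> y \<in> X \<Longrightarrow> z \<in> X \<Longrightarrow> d x z \<le> d x y + d y z"
    using fm unfolding finite_metric_def by blast+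
  have "\<exists>S g. card S = cover_number X d (R k) \<and> S \<subseteq> X \<and> (\<forall>x\<in>X. g x \<in> S \<and> d x (g x) \<le> R k)" for k
  proof -
    obtain S where "S \<subseteq> X" and S: "\<forall>x\<in>X. \<exists>y\<in>S. d x y \<le> R k" and "card S = cover_number X d (R k)"
      using cover_number_attained[OF fm R0] by blast
    moreover obtain g where "\<forall>x\<in>X. g x \<in> S \<and> d x (g x) \<le> R k"
      using bchoice[OF S[unfolded Bex_def]] by auto
    ultimately show ?thesis by blast
  qed
  then obtain S g where S: "\<And>k. card (S k) = cover_number X d (R k)" "\<And>k. S k \<subseteq> X"
    and g: "\<And>k x. x \<in> X \<Longrightarrow> g k x \<in> S k" "\<And>k x. x \<in> X \<Longrightarrow> d x (g k x) \<le> R k"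
    by metis
  \<comment> \<open>The recursion climbs from the leaves: \<open>G i\<close> composes the maps of
    the \<open>i\<close> finest levels, starting from the identity. Re-indexing by
    \<open>N - k\<close> turns this into \<open>F k = g k o F (k + 1)\<close>.\<close>
  define G where "G = rec_nat (\<lambda>x. x) (\<lambda>i h x. g (N - Suc i) (h x))"
  define F where "F k = G (N - k)" for k
  have FN: "F N x = x" for x by (simp add: F_def G_def)
  have FS: "F k x = g k (F (Suc k) x)" if "k < N" for k x
  proof -
    have "N - k = Suc (N - Suc k)" using that by simp
    then show ?thesis using that by (simp add: F_def G_def)
  qed
  \<comment> \<open>The path from a leaf up to its level-\<open>k\<close> ancestor has steps of
    length at most \<open>R j\<close> for \<open>k \<le> j < N\<close>, and \<open>H k\<close> is
    the sum of these radii.\<close>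
  have FX: "F k x \<in> X \<and> d x (F k x) \<le> H k" if "k \<le> N" "x \<in> X" for k x
    using that(1)
  proof (induction rule: inc_induct)
    case base
    then show ?case using FN HN refl that(2) by simp
  next
    case (step n)
    let ?y = "F (Suc n) x"
    have y: "?y \<in> X" "d x ?y \<le> H (Suc n)" using step.IH by auto
    then have gy: "g n ?y \<in> X" "d ?y (g n ?y) \<le> R n" using g[of ?y n] S(2)[of n] by auto
    have "d x (g n ?y) \<le> d x ?y + d ?y (g n ?y)"
      using tri that(2) y(1) gy(1) by blast
    with y gy show ?case unfolding FS[OF \<open>n < N\<close>] HS[OF \<open>n < N\<close>] by simp
  qed
  show ?thesis
  proof (rule that[of F])
    show "F k x = F k y" if "k < N" "F (Suc k) x = F (Suc k) y" for k x y
      using that(2) unfolding FS[OF that(1)] by simp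
    show "card (F k ` X) \<le> cover_number X d (R k)" if "k < N" for k
      unfolding S(1)[symmetric]
    proof (intro card_mono)
      show "finite (S k)" using S(2) fin finite_subset by blast
      show "F k ` X \<subseteq> S k" using FX[of "Suc k"] g(1) that unfolding FS[OF that] by auto
    qed
    show "d x y \<le> 2 * H k" if k: "k \<le> N" and xy: "x \<in> X" "y \<in> X" and "F k x = F k y" for k x y
    proof -
      have "d x y \<le> d x (F k x) + d (F k x) y" "d (F k x) y = d y (F k x)"
        using tri sym xy FX[OF k xy(1)] by blast+
      then show ?thesis using FX[OF k xy(1)] FX[OF k xy(2)] \<open>F k x = F k y\<close> by simp
    qed
  qed (rule FN)
qed

subsection \<open>Moments of the Poisson model\<close>

text \<open>This is nonnegativity of the variance of the absolute value.\<close>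

lemma (in prob_space) expectation_abs_le_sqrt:
  fixes f :: "'a \<Rightarrow> real"
  assumes [measurable]: "f \<in> borel_measurable M" and f2: "integrable M (\<lambda>x. (f x)\<^sup>2)"
  shows "expectation (\<lambda>x. \<bar>f x\<bar>) \<le> sqrt (expectation (\<lambda>x. (f x)\<^sup>2))"
proof -
  have "integrable M f" by (rule square_integrable_imp_integrable[OF assms])
  then have "variance (\<lambda>x. \<bar>f x\<bar>) = expectation (\<lambda>x. (f x)\<^sup>2) - (expectation (\<lambda>x. \<bar>f x\<bar>))\<^sup>2"
    using f2 by (subst variance_eq) auto
  then have "(expectation (\<lambda>x. \<bar>f x\<bar>))\<^sup>2 \<le> expectation (\<lambda>x. (f x)\<^sup>2)"
    using variance_positive[of "\<lambda>x. \<bar>f x\<bar>"] by simp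
  then show ?thesis by (rule real_le_rsqrt)
qed

text \<open>When the square is expanded, independence factorises the off-diagonal expectations and
  centring makes them vanish.\<close>

lemma (in prob_space) expectation_square_sum_indep:
  fixes Z :: "'b \<Rightarrow> 'a \<Rightarrow> real"
  assumes fin: "finite I" and ind: "indep_vars (\<lambda>_. borel) Z I"
    and sq: "\<And>i. i \<in> I \<Longrightarrow> integrable M (\<lambda>x. (Z i x)\<^sup>2)"
    and centred: "\<And>i. i \<in> I \<Longrightarrow> expectation (Z i) = 0"
  shows "integrable M (\<lambda>x. (\<Sum>i\<in>I. Z i x)\<^sup>2)"
    and "expectation (\<lambda>x. (\<Sum>i\<in>I. Z i x)\<^sup>2) = (\<Sum>i\<in>I. expectation (\<lambda>x. (Z i x)\<^sup>2))"
proof -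
  have rv: "i \<in> I \<Longrightarrow> random_variable borel (Z i)" for i using ind by (auto simp: indep_vars_def)
  have int: "i \<in> I \<Longrightarrow> integrable M (Z i)" for i
    using square_integrable_imp_integrable[OF rv] sq by blast
  have prod: "integrable M (\<lambda>x. Z i x * Z j x) \<and>
      expectation (\<lambda>x. Z i x * Z j x) = (if i = j then expectation (\<lambda>x. (Z i x)\<^sup>2) else 0)"
    if ij: "i \<in> I" "j \<in> I" for i j
  proof (cases "i = j")
    case True
    then show ?thesis using sq ij by (simp add: power2_eq_square)
  next
    case False
    have "indep_vars (\<lambda>_. borel) Z {i, j}" using ind ij by (intro indep_vars_subset[OF ind]) auto
    then show ?thesis
      using indep_vars_integrable[of "{i, j}" Z] indep_vars_lebesgue_integral[of "{i, j}" Z]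
        int ij centred False by auto
  qed
  have expand: "(\<lambda>x. (\<Sum>i\<in>I. Z i x)\<^sup>2) = (\<lambda>x. \<Sum>i\<in>I. \<Sum>j\<in>I. Z i x * Z j x)"
    by (simp add: power2_eq_square sum_product)
  show "integrable M (\<lambda>x. (\<Sum>i\<in>I. Z i x)\<^sup>2)"
    unfolding expand using prod by (intro Bochner_Integration.integrable_sum) auto
  have "expectation (\<lambda>x. \<Sum>i\<in>I. \<Sum>j\<in>I. Z i x * Z j x)
      = (\<Sum>i\<in>I. \<Sum>j\<in>I. expectation (\<lambda>x. Z i x * Z j x))"
    using prod by (simp add: Bochner_Integration.integral_sum)
  also have "\<dots> = (\<Sum>i\<in>I. expectation (\<lambda>x. (Z i x)\<^sup>2))"
    using prod fin by (intro sum.cong) (auto simp: sum.delta)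
  finally show "expectation (\<lambda>x. (\<Sum>i\<in>I. Z i x)\<^sup>2) = (\<Sum>i\<in>I. expectation (\<lambda>x. (Z i x)\<^sup>2))"
    unfolding expand .
qed

text \<open>The Stein-Chen identity, from the recursion \<open>(n + 1) * w (n + 1) = r * w n\<close>
  of the Poisson weights \<open>w\<close>. For nonnegative extended integrands it needs no
  integrability, and \<open>g = 1\<close> and \<open>g n = n\<close> give the first two moments. For
  \<open>r = 0\<close>, where \<open>poi\<close> is the point mass at 0, both sides vanish.\<close>

lemma nn_integral_poi_of_nat_mult:
  fixes g :: "nat \<Rightarrow> ennreal"
  assumes "0 \<le> r"
  shows "(\<integral>\<^sup>+ n. of_nat n * g n \<partial>poi r) = ennreal r * (\<integral>\<^sup>+ n. g (Suc n) \<partial>poi r)"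
proof (cases "r = 0")
  case True
  then show ?thesis by (simp add: poi_def)
next
  case False
  with assms have r: "0 < r" by simp
  let ?f = "\<lambda>n. ennreal (pmf (poisson_pmf r) n) * (of_nat n * g n)"
  have shift: "?f (Suc n) = ennreal r * (ennreal (pmf (poisson_pmf r) n) * g (Suc n))" for n
  proof -
    have "pmf (poisson_pmf r) (Suc n) * real (Suc n) = r * pmf (poisson_pmf r) n"
      using r by (simp add: divide_simps)
    then have "ennreal (pmf (poisson_pmf r) (Suc n)) * of_nat (Suc n) = ennreal r * ennreal (pmf (poisson_pmf r) n)"
      using r by (metis ennreal_mult ennreal_of_nat_eq_real_of_nat less_imp_le of_nat_0_le_iff pmf_nonneg)
    then show ?thesis by (metis mult.assoc)
  qed
  have "(\<integral>\<^sup>+ n. of_nat n * g n \<partial>poi r) = (\<Sum>n. ?f n)"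
    using False by (simp add: poi_def nn_integral_measure_pmf nn_integral_count_space_nat del: pmf_poisson)
  \<comment> \<open>The term at 0 carries the factor \<open>of_nat 0\<close>, so only the shifted
    series survives.\<close>
  also have "\<dots> = (\<Sum>n. ?f (Suc n)) + ?f 0"
    by (rule sums_unique[symmetric], rule sums_Suc, rule summable_sums, rule summableI)
  also have "\<dots> = ennreal r * (\<Sum>n. ennreal (pmf (poisson_pmf r) n) * g (Suc n))"
    unfolding shift by simp
  also have "(\<Sum>n. ennreal (pmf (poisson_pmf r) n) * g (Suc n)) = (\<integral>\<^sup>+ n. g (Suc n) \<partial>poi r)"
    using False by (simp add: poi_def nn_integral_measure_pmf nn_integral_count_space_nat del: pmf_poisson)
  finally show ?thesis .
qed

lemma has_bochner_integral_poi:
  assumes "0 \<le> r"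
  shows "has_bochner_integral (poi r) real r"
    and "has_bochner_integral (poi r) (\<lambda>n. (real n)\<^sup>2) (r\<^sup>2 + r)"
proof -
  have 1: "(\<integral>\<^sup>+ n. of_nat n \<partial>poi r) = ennreal r"
    using nn_integral_poi_of_nat_mult[OF assms, of "\<lambda>_. 1"] by simp
  then show "has_bochner_integral (poi r) real r"
    using assms by (intro has_bochner_integral_nn_integral) (auto simp: ennreal_of_nat_eq_real_of_nat)
  have "(\<integral>\<^sup>+ n. ennreal ((real n)\<^sup>2) \<partial>poi r) = (\<integral>\<^sup>+ n. of_nat n * of_nat n \<partial>poi r)"
    by (intro nn_integral_cong) (simp add: power2_eq_square ennreal_mult ennreal_of_nat_eq_real_of_nat)
  also have "\<dots> = ennreal r * (\<integral>\<^sup>+ n. of_nat n + 1 \<partial>poi r)"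
    by (subst nn_integral_poi_of_nat_mult[OF assms]) (simp add: add.commute)
  also have "(\<integral>\<^sup>+ n. of_nat n + 1 \<partial>poi r) = ennreal r + 1"
    by (subst nn_integral_add) (simp_all add: 1)
  also have "ennreal r * (ennreal r + 1) = ennreal (r\<^sup>2 + r)"
    using assms by (simp add: distrib_left ennreal_mult power2_eq_square)
  finally show "has_bochner_integral (poi r) (\<lambda>n. (real n)\<^sup>2) (r\<^sup>2 + r)"
    using assms by (intro has_bochner_integral_nn_integral) auto
qed

text \<open>Conditioning on the coin. Nonnegativity of \<open>g\<close> allows the iterated integral
  to be computed before integrability is known.\<close>

lemma has_bochner_integral_pair_bernoulli:
  fixes g :: "'a \<times> bool \<Rightarrow> real"
  assumes s: "0 \<le> s" "s \<le> 1" and g0: "\<And>y. 0 \<le> g y"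
    and T: "has_bochner_integral (measure_pmf M) (\<lambda>n. g (n, True)) a"
    and F: "has_bochner_integral (measure_pmf M) (\<lambda>n. g (n, False)) b"
  shows "has_bochner_integral (pair_pmf M (bernoulli_pmf s)) g (s * a + (1 - s) * b)"
proof -
  have a: "0 \<le> a" "(\<integral>\<^sup>+ n. g (n, True) \<partial>M) = ennreal a"
    using T g0 nn_integral_eq_integral[of "measure_pmf M" "\<lambda>n. g (n, True)"]
    by (auto simp: has_bochner_integral_iff)
  have b: "0 \<le> b" "(\<integral>\<^sup>+ n. g (n, False) \<partial>M) = ennreal b"
    using F g0 nn_integral_eq_integral[of "measure_pmf M" "\<lambda>n. g (n, False)"]
    by (auto simp: has_bochner_integral_iff)
  have "(\<integral>\<^sup>+ y. g y \<partial>pair_pmf M (bernoulli_pmf s))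
      = (\<integral>\<^sup>+ n. ennreal (g (n, True)) * ennreal s + ennreal (g (n, False)) * ennreal (1 - s) \<partial>M)"
    using s by (simp add: nn_integral_pair_pmf')
  also have "\<dots> = ennreal a * ennreal s + ennreal b * ennreal (1 - s)"
    by (simp add: nn_integral_add nn_integral_multc a b)
  also have "\<dots> = ennreal (s * a + (1 - s) * b)"
    using s a b by (simp add: ennreal_mult[symmetric] ennreal_plus[symmetric] mult.commute del: ennreal_plus)
  finally show ?thesis using s a b g0 by (intro has_bochner_integral_nn_integral) auto
qed

section \<open>The estimation error at a single point, with \<open>m\<close> standing for its
  mass\<close>

context
  fixes t s m :: real
  assumes t: "0 < t" and s: "0 < s" "s \<le> 1" and m: "0 \<le> m"
begin

abbreviation (input) "site \<equiv> pair_pmf (poi (t * m)) (bernoulli_pmf s)"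
abbreviation (input) "thinned \<equiv> \<lambda>y::nat \<times> bool. if snd y then real (fst y) else 0"

lemma site_thinned: "has_bochner_integral site thinned (s * (t * m))"
  using has_bochner_integral_pair_bernoulli[of s thinned "poi (t * m)" "t * m" 0]
    has_bochner_integral_poi(1)[of "t * m"] t s m by (simp add: has_bochner_integral_zero)

lemma site_thinned_square: "has_bochner_integral site (\<lambda>y. (thinned y)\<^sup>2) (s * ((t * m)\<^sup>2 + t * m))"
  using has_bochner_integral_pair_bernoulli[of s "\<lambda>y. (thinned y)\<^sup>2" "poi (t * m)" "(t * m)\<^sup>2 + t * m" 0]
    has_bochner_integral_poi(2)[of "t * m"] t s m by (simp add: has_bochner_integral_zero)

text \<open>The centred error changes sign, so it is reached by linearity from the nonnegative
  thinned count.\<close>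

lemma site_error: "has_bochner_integral site (\<lambda>y. thinned y / (s * t) - m) 0"
proof -
  have "has_bochner_integral site (\<lambda>y. thinned y / (s * t) - m) (s * (t * m) / (s * t) - m)"
    using site_thinned
    by (intro has_bochner_integral_diff has_bochner_integral_divide_zero) (auto simp: has_bochner_integral_iff)
  then show ?thesis using t s by simp
qed

text \<open>Expanding the square, the Poisson fluctuation contributes \<open>m / (s * t)\<close> and
  the coin contributes \<open>(1 / s - 1) * m\<^sup>2\<close>.\<close>

lemma site_error_square:
  "has_bochner_integral site (\<lambda>y. (thinned y / (s * t) - m)\<^sup>2) (m / (s * t) + (1 - s) / s * m\<^sup>2)"
proof -
  have "has_bochner_integral site
      (\<lambda>y. (thinned y)\<^sup>2 * (1 / (s * t)\<^sup>2) - thinned y * (2 * m / (s * t)) + m\<^sup>2)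
      (s * ((t * m)\<^sup>2 + t * m) * (1 / (s * t)\<^sup>2) - s * (t * m) * (2 * m / (s * t)) + m\<^sup>2)"
    using site_thinned site_thinned_square
    by (intro has_bochner_integral_add has_bochner_integral_diff has_bochner_integral_mult_left)
       (auto simp: has_bochner_integral_iff)
  also have "(\<lambda>y. (thinned y)\<^sup>2 * (1 / (s * t)\<^sup>2) - thinned y * (2 * m / (s * t)) + m\<^sup>2)
      = (\<lambda>y. (thinned y / (s * t) - m)\<^sup>2)"
    by (simp add: power2_diff power_divide fun_eq_iff mult.commute)
  also have "s * ((t * m)\<^sup>2 + t * m) * (1 / (s * t)\<^sup>2) - s * (t * m) * (2 * m / (s * t)) + m\<^sup>2
      = m / (s * t) + (1 - s) / s * m\<^sup>2"
    using t s by (simp add: field_simps power2_eq_square)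
  finally show ?thesis .
qed

text \<open>The factor 2 in front of \<open>(1 - s) * m\<close> collects two effects. A failed coin,
  of probability \<open>1 - s\<close>, loses the whole mass \<open>m\<close>. After a successful
  coin the count has mean \<open>r = t * m\<close> but is compared with \<open>s * r\<close>, a bias
  of \<open>(1 - s) * r\<close>. The probability \<open>s\<close> of success cancels the
  \<open>1 / s\<close> of the estimator.\<close>

lemma site_error_abs:
  "measure_pmf.expectation site (\<lambda>y. \<bar>thinned y / (s * t) - m\<bar>) \<le> 2 * (1 - s) * m + s / sqrt t * sqrt m"
proof -
  define r where "r = t * m"
  have r: "0 \<le> r" using t m by (simp add: r_def)
  let ?E = "measure_pmf.expectation (poi r)"
  have iP: "integrable (poi r) real" and iP2: "integrable (poi r) (\<lambda>n. (real n)\<^sup>2)"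
    and EP: "?E real = r" and EP2: "?E (\<lambda>n. (real n)\<^sup>2) = r\<^sup>2 + r"
    using has_bochner_integral_poi[OF r] by (auto simp: has_bochner_integral_iff)
  have dev: "(\<lambda>n. (real n - r)\<^sup>2) = (\<lambda>n. (real n)\<^sup>2 - 2 * r * real n + r\<^sup>2)"
    by (simp add: power2_diff fun_eq_iff)
  have "?E (\<lambda>n. \<bar>real n - r\<bar>) \<le> sqrt (?E (\<lambda>n. (real n - r)\<^sup>2))"
    by (rule measure_pmf.expectation_abs_le_sqrt) (auto simp: dev iP iP2)
  also have "?E (\<lambda>n. (real n - r)\<^sup>2) = r"
    unfolding dev using iP iP2 by (simp add: EP EP2) (simp add: power2_eq_square)
  finally have dev1: "?E (\<lambda>n. \<bar>real n - r\<bar>) \<le> sqrt r" .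
  have "?E (\<lambda>n. \<bar>real n - s * r\<bar>) \<le> ?E (\<lambda>n. (1 - s) * real n + s * \<bar>real n - r\<bar>)"
  proof (rule integral_mono)
    fix n
    \<comment> \<open>Centring at \<open>r\<close> instead of \<open>s * r\<close> keeps the factor \<open>s\<close> in front of \<open>sqrt r\<close>.\<close>
    have "real n - s * r = (1 - s) * real n + s * (real n - r)" by (simp add: algebra_simps)
    also have "\<bar>\<dots>\<bar> \<le> \<bar>(1 - s) * real n\<bar> + \<bar>s * (real n - r)\<bar>" by (rule abs_triangle_ineq)
    finally show "\<bar>real n - s * r\<bar> \<le> (1 - s) * real n + s * \<bar>real n - r\<bar>"
      using s by (simp add: abs_mult)
  qed (use iP in auto)
  also have "\<dots> = (1 - s) * r + s * ?E (\<lambda>n. \<bar>real n - r\<bar>)" using iP by (simp add: EP)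
  also have "\<dots> \<le> (1 - s) * r + s * sqrt r" using dev1 s by simp
  finally have main: "?E (\<lambda>n. \<bar>real n - s * r\<bar>) \<le> (1 - s) * r + s * sqrt r" .
  have abs_eq: "(\<lambda>n. \<bar>real n / (s * t) - m\<bar>) = (\<lambda>n. \<bar>real n - s * r\<bar> * (1 / (s * t)))"
  proof
    fix n
    have "real n / (s * t) - m = (real n - s * r) / (s * t)" using t s by (simp add: r_def field_simps)
    then show "\<bar>real n / (s * t) - m\<bar> = \<bar>real n - s * r\<bar> * (1 / (s * t))" using t s by (simp add: abs_mult)
  qed
  have "has_bochner_integral site (\<lambda>y. \<bar>thinned y / (s * t) - m\<bar>)
      (s * (?E (\<lambda>n. \<bar>real n - s * r\<bar>) * (1 / (s * t))) + (1 - s) * m)"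
    unfolding r_def[symmetric]
  proof (rule has_bochner_integral_pair_bernoulli)
    show "has_bochner_integral (poi r) (\<lambda>n. \<bar>thinned (n, True) / (s * t) - m\<bar>)
      (?E (\<lambda>n. \<bar>real n - s * r\<bar>) * (1 / (s * t)))"
      unfolding snd_conv fst_conv if_True abs_eq using iP
      by (intro has_bochner_integral_mult_left) (auto simp: has_bochner_integral_iff)
  qed (use s m in \<open>auto simp: has_bochner_integral_iff\<close>)
  then have "measure_pmf.expectation site (\<lambda>y. \<bar>thinned y / (s * t) - m\<bar>)
      = ?E (\<lambda>n. \<bar>real n - s * r\<bar>) / t + (1 - s) * m"
    using s by (simp add: has_bochner_integral_iff)
  also have "\<dots> \<le> ((1 - s) * r + s * sqrt r) / t + (1 - s) * m"
    using main t by (simp add: divide_right_mono)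
  also have "((1 - s) * r + s * sqrt r) / t = (1 - s) * m + s * (sqrt t * sqrt m / t)"
    using t by (simp add: r_def real_sqrt_mult add_divide_distrib)
  also have "sqrt t * sqrt m / t = sqrt m / sqrt t"
    using t by (simp add: field_simps)
  finally show ?thesis by (simp add: algebra_simps)
qed

end

section \<open>Cauchy-Schwarz and Jensen inequalities for roots\<close>

lemma sum_sqrt_le:
  fixes w :: "'a \<Rightarrow> real"
  assumes "\<And>i. i \<in> I \<Longrightarrow> 0 \<le> w i"
  shows "(\<Sum>i\<in>I. sqrt (w i)) \<le> sqrt (real (card I)) * sqrt (\<Sum>i\<in>I. w i)"
proof -
  have "(\<Sum>i\<in>I. 1 * sqrt (w i))\<^sup>2 \<le> (\<Sum>i\<in>I. 1\<^sup>2) * (\<Sum>i\<in>I. (sqrt (w i))\<^sup>2)"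
    by (rule Cauchy_Schwarz_ineq_sum)
  also have "(\<Sum>i\<in>I. (sqrt (w i))\<^sup>2) = (\<Sum>i\<in>I. w i)" using assms by (intro sum.cong) auto
  finally have "(\<Sum>i\<in>I. sqrt (w i))\<^sup>2 \<le> real (card I) * (\<Sum>i\<in>I. w i)" by simp
  then show ?thesis unfolding real_sqrt_mult[symmetric] by (rule real_le_rsqrt)
qed

text \<open>Jensen's inequality for the concave function \<open>y powr (1 / p)\<close>, proved with
  a supporting line at the upper bound \<open>a\<close> instead of at the mean itself.\<close>

lemma nn_integral_powr_inverse_le:
  fixes W :: "'a \<Rightarrow> real"
  assumes p: "1 \<le> p" and W0: "\<And>x. 0 \<le> W x" and int: "integrable (measure_pmf M) W"
    and le: "measure_pmf.expectation M W \<le> a"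
  shows "(\<integral>\<^sup>+ x. ennreal (W x powr (1 / p)) \<partial>M) \<le> ennreal (a powr (1 / p))"
\<comment> \<open>For \<open>p > 1\<close> the root has no finite slope at 0, so this case is
  separate: a nonnegative variable with expectation 0 vanishes almost surely.\<close>
proof (cases "a = 0")
  case True
  have "0 \<le> measure_pmf.expectation M W" using W0 by simp
  with True le have "measure_pmf.expectation M W = 0" by simp
  then have "AE x in M. W x = 0" using integral_nonneg_eq_0_iff_AE[OF int] W0 by simp
  then have "(\<integral>\<^sup>+ x. ennreal (W x powr (1 / p)) \<partial>M) = (\<integral>\<^sup>+ x. 0 \<partial>M)"
    by (intro nn_integral_cong_AE) auto
  then show ?thesis by simp
next
  case False
  have "0 \<le> measure_pmf.expectation M W" using W0 by simp
  with le False have a: "0 < a" by simp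
  \<comment> \<open>The tangent to \<open>y powr (1 / p)\<close> at \<open>y = a\<close>, evaluated
    at \<open>W x\<close>. That it lies above the curve is Young's inequality with exponents
    \<open>1 / p\<close> and \<open>1 - 1 / p\<close>.\<close>
  let ?T = "\<lambda>x. a powr (1 / p - 1) * (1 / p * W x + (1 - 1 / p) * a)"
  have T: "W x powr (1 / p) \<le> ?T x" for x
  proof (cases "W x = 0")
    case True
    then show ?thesis using p a by simp
  next
    case False
    with W0[of x] have "W x powr (1 / p) * a powr (1 - 1 / p) \<le> 1 / p * W x + (1 - 1 / p) * a"
      using p a by (intro Youngs_inequality_0) auto
    then have "a powr (1 / p - 1) * (W x powr (1 / p) * a powr (1 - 1 / p)) \<le> ?T x"
      by (rule mult_left_mono) simp
    moreover have "a powr (1 / p - 1) * a powr (1 - 1 / p) = 1" using a by (simp add: powr_add[symmetric])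
    ultimately show ?thesis by (simp add: mult.left_commute)
  qed
  have "(\<integral>\<^sup>+ x. ennreal (W x powr (1 / p)) \<partial>M) \<le> (\<integral>\<^sup>+ x. ennreal (?T x) \<partial>M)"
    using T by (intro nn_integral_mono ennreal_leI)
  also have "\<dots> = ennreal (measure_pmf.expectation M ?T)"
    using int W0 p a by (intro nn_integral_eq_integral) auto
  also have "measure_pmf.expectation M ?T
      = a powr (1 / p - 1) * (1 / p * measure_pmf.expectation M W + (1 - 1 / p) * a)"
    using int by simp
  also have "\<dots> \<le> a powr (1 / p - 1) * (1 / p * a + (1 - 1 / p) * a)"
    using le p by (intro mult_left_mono add_right_mono) auto
  also have "\<dots> = a powr (1 / p - 1) * a powr 1" using a by (simp add: algebra_simps)
  also have "\<dots> = a powr (1 / p)" unfolding powr_add[symmetric] by simp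
  finally show ?thesis by (simp add: ennreal_leI)
qed

section \<open>Expected imbalance of a partition under the full Poisson model\<close>

lemma poisson_model_component:
  assumes "finite X" "x \<in> X"
  shows "map_pmf (\<lambda>\<omega>. \<omega> x) (poisson_model X \<mu> t s) = pair_pmf (poi (t * \<mu> x)) (bernoulli_pmf s)"
  using assms by (simp add: poisson_model_def Pi_pmf_component)

context
  fixes X :: "'a set" and \<mu> :: "'a \<Rightarrow> real" and t s :: real
  assumes fin: "finite X" and \<mu>: "\<And>x. x \<in> X \<Longrightarrow> 0 \<le> \<mu> x" and t: "0 < t" and s: "0 < s" "s \<le> 1"
begin

abbreviation (input) "\<P> \<equiv> poisson_model X \<mu> t s"

lemma component_expectation:
  fixes g :: "nat \<times> bool \<Rightarrow> real"
  assumes "x \<in> X"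
  shows "integrable \<P> (\<lambda>\<omega>. g (\<omega> x)) \<longleftrightarrow> integrable (pair_pmf (poi (t * \<mu> x)) (bernoulli_pmf s)) g"
    and "measure_pmf.expectation \<P> (\<lambda>\<omega>. g (\<omega> x))
      = measure_pmf.expectation (pair_pmf (poi (t * \<mu> x)) (bernoulli_pmf s)) g"
  unfolding poisson_model_component[OF fin assms, symmetric] by simp_all

lemma error_expectation:
  assumes "x \<in> X"
  shows "integrable \<P> (\<lambda>\<omega>. estimator t s \<omega> x - \<mu> x)"
    and "measure_pmf.expectation \<P> (\<lambda>\<omega>. estimator t s \<omega> x - \<mu> x) = 0"
    and "integrable \<P> (\<lambda>\<omega>. (estimator t s \<omega> x - \<mu> x)\<^sup>2)"
    and "measure_pmf.expectation \<P> (\<lambda>\<omega>. (estimator t s \<omega> x - \<mu> x)\<^sup>2)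
      = \<mu> x / (s * t) + (1 - s) / s * (\<mu> x)\<^sup>2"
    and "measure_pmf.expectation \<P> (\<lambda>\<omega>. \<bar>estimator t s \<omega> x - \<mu> x\<bar>)
      \<le> 2 * (1 - s) * \<mu> x + s / sqrt t * sqrt (\<mu> x)"
  using component_expectation[OF assms, of "\<lambda>y. thinned y / (s * t) - \<mu> x"]
    component_expectation[OF assms, of "\<lambda>y. (thinned y / (s * t) - \<mu> x)\<^sup>2"]
    component_expectation(2)[OF assms, of "\<lambda>y. \<bar>thinned y / (s * t) - \<mu> x\<bar>"]
    site_error[OF t s \<mu>[OF assms]] site_error_square[OF t s \<mu>[OF assms]] site_error_abs[OF t s \<mu>[OF assms]]
  unfolding estimator_def has_bochner_integral_iff by simp_all

lemma errors_indep:
  assumes "V \<subseteq> X"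
  shows "prob_space.indep_vars \<P> (\<lambda>_. borel) (\<lambda>x \<omega>. estimator t s \<omega> x - \<mu> x) V"
proof -
  have "prob_space.indep_vars \<P> (\<lambda>_. count_space UNIV) (\<lambda>x \<omega>. \<omega> x) X"
    unfolding poisson_model_def by (rule indep_vars_Pi_pmf[OF fin])
  then have "prob_space.indep_vars \<P> (\<lambda>_. count_space UNIV) (\<lambda>x \<omega>. \<omega> x) V"
    by (rule prob_space.indep_vars_subset[OF measure_pmf.prob_space_axioms _ assms])
  then show ?thesis
    unfolding estimator_def
    by (rule prob_space.indep_vars_compose2[OF measure_pmf.prob_space_axioms, where Y = "\<lambda>x y. thinned y / (s * t) - \<mu> x"]) simp
qed

lemma imbalance_integrable: "integrable \<P> (\<lambda>\<omega>. imbalance X f (estimator t s \<omega>) \<mu>)"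
  unfolding imbalance_def
  by (intro Bochner_Integration.integrable_sum integrable_abs) (simp add: error_expectation(1))

lemma expected_imbalance_le_sqrt_card:
  "measure_pmf.expectation \<P> (\<lambda>\<omega>. imbalance X f (estimator t s \<omega>) \<mu>)
    \<le> sqrt (real (card (f ` X))) * sqrt (mass X \<mu> / (s * t) + (1 - s) / s * (\<Sum>x\<in>X. (\<mu> x)\<^sup>2))"
proof -
  define w where "w x = \<mu> x / (s * t) + (1 - s) / s * (\<mu> x)\<^sup>2" for x
  define V where "V v = {x. x \<in> X \<and> f x = v}" for v
  have V: "finite (V v)" "V v \<subseteq> X" for v using fin by (auto simp: V_def)
  have w0: "0 \<le> w x" if "x \<in> X" for x using \<mu>[OF that] t s by (simp add: w_def)
  have fibre: "measure_pmf.expectation \<P> (\<lambda>\<omega>. \<bar>\<Sum>x\<in>V v. estimator t s \<omega> x - \<mu> x\<bar>) \<le> sqrt (sum w (V v))" for v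
  proof -
    have "measure_pmf.expectation \<P> (\<lambda>\<omega>. \<bar>\<Sum>x\<in>V v. estimator t s \<omega> x - \<mu> x\<bar>)
      \<le> sqrt (measure_pmf.expectation \<P> (\<lambda>\<omega>. (\<Sum>x\<in>V v. estimator t s \<omega> x - \<mu> x)\<^sup>2))"
      by (intro measure_pmf.expectation_abs_le_sqrt measure_pmf.expectation_square_sum_indep
          V errors_indep error_expectation) (use V(2) in auto)
    also have "measure_pmf.expectation \<P> (\<lambda>\<omega>. (\<Sum>x\<in>V v. estimator t s \<omega> x - \<mu> x)\<^sup>2)
      = (\<Sum>x\<in>V v. measure_pmf.expectation \<P> (\<lambda>\<omega>. (estimator t s \<omega> x - \<mu> x)\<^sup>2))"
      by (intro measure_pmf.expectation_square_sum_indep V errors_indep error_expectation) (use V(2) in auto)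
    also have "\<dots> = sum w (V v)"
      using V(2)[of v] by (intro sum.cong) (auto simp: error_expectation(4) w_def)
    finally show ?thesis .
  qed
  have "measure_pmf.expectation \<P> (\<lambda>\<omega>. imbalance X f (estimator t s \<omega>) \<mu>)
      = (\<Sum>v\<in>f ` X. measure_pmf.expectation \<P> (\<lambda>\<omega>. \<bar>\<Sum>x\<in>V v. estimator t s \<omega> x - \<mu> x\<bar>))"
    unfolding imbalance_def V_def
    by (intro Bochner_Integration.integral_sum integrable_abs Bochner_Integration.integrable_sum)
       (simp add: error_expectation(1))
  also have "\<dots> \<le> (\<Sum>v\<in>f ` X. sqrt (sum w (V v)))" by (intro sum_mono fibre)
  also have "\<dots> \<le> sqrt (real (card (f ` X))) * sqrt (\<Sum>v\<in>f ` X. sum w (V v))"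
    using V(2) w0 by (intro sum_sqrt_le sum_nonneg) blast
  also have "(\<Sum>v\<in>f ` X. sum w (V v)) = sum w X"
    unfolding V_def sum.image_gen[OF fin, symmetric] ..
  also have "sum w X = mass X \<mu> / (s * t) + (1 - s) / s * (\<Sum>x\<in>X. (\<mu> x)\<^sup>2)"
    by (simp add: w_def mass_def sum.distrib sum_divide_distrib sum_distrib_left)
  finally show ?thesis .
qed

text \<open>At the leaves the fibres are singletons, so nothing cancels inside them and the
  pointwise absolute-error bounds are summed instead of variances. This serves the regime of small
  \<open>C\<close>.\<close>

lemma expected_total_variation_le:
  assumes f: "\<And>x. f x = x"
  shows "measure_pmf.expectation \<P> (\<lambda>\<omega>. imbalance X f (estimator t s \<omega>) \<mu>)
    \<le> 2 * (1 - s) * mass X \<mu> + s / sqrt t * (\<Sum>x\<in>X. sqrt (\<mu> x))"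
proof -
  have "{x. x \<in> X \<and> x = v} = {v}" if "v \<in> X" for v using that by auto
  then have "imbalance X f \<nu> \<mu> = (\<Sum>x\<in>X. \<bar>\<nu> x - \<mu> x\<bar>)" for \<nu>
    unfolding imbalance_def by (simp add: f)
  then have "measure_pmf.expectation \<P> (\<lambda>\<omega>. imbalance X f (estimator t s \<omega>) \<mu>)
      = (\<Sum>x\<in>X. measure_pmf.expectation \<P> (\<lambda>\<omega>. \<bar>estimator t s \<omega> x - \<mu> x\<bar>))"
    using error_expectation(1) by (simp add: Bochner_Integration.integral_sum)
  also have "\<dots> \<le> (\<Sum>x\<in>X. 2 * (1 - s) * \<mu> x + s / sqrt t * sqrt (\<mu> x))"
    by (intro sum_mono error_expectation(5))
  finally show ?thesis by (simp add: sum.distrib sum_distrib_left mass_def)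
qed

end

subsection \<open>The expected distance\<close>

text \<open>The tree has levels 0 to \<open>Suc L\<close>: the covers occupy 0 to \<open>L\<close>,
  and the points of \<open>X\<close> sit at \<open>Suc L\<close>.\<close>

lemma height_top: "height X d q L (Suc L) = 0"
  by (simp add: height_def)

text \<open>The closed form of \<open>height\<close> is the geometric sum of the cover radii from
  level \<open>k\<close> to \<open>L\<close>; this recursion is the one that
  \<open>nested_covers\<close> asks for.\<close>

lemma height_step:
  assumes "1 < q"
  shows "height X d q L k = q powr (- real k) * diam_fm X d + height X d q L (Suc k)"
proof -
  have "q powr (1 - real k) = q * q powr (- real k)" using assms powr_add[of q 1 "- real k"] by simp
  moreover have "q powr (1 - real (Suc k)) = q powr (- real k)" by (simp add: algebra_simps)
  ultimately show ?thesis using assms by (simp add: height_def field_simps)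
qed

lemma height_antimono:
  assumes "1 < q" "0 \<le> diam_fm X d" "j \<le> k"
  shows "height X d q L k \<le> height X d q L j"
  using assms(3)
proof (induction rule: dec_induct)
  case (step n)
  have "0 \<le> q powr (- real n) * diam_fm X d" using assms(2) by simp
  then show ?case using step.IH height_step[OF assms(1), of X d L n] by linarith
qed simp

lemma height_nonneg:
  assumes "1 < q" "0 \<le> diam_fm X d" "k \<le> Suc L"
  shows "0 \<le> height X d q L k"
  using height_antimono[OF assms, of L] by (simp add: height_top)

lemma dist_le_diam:
  assumes "finite X" "x \<in> X" "y \<in> X"
  shows "d x y \<le> diam_fm X d"
proof -
  have "finite {d x y | x y. x \<in> X \<and> y \<in> X}" using assms by (simp add: finite_image_set2)
  then show ?thesis unfolding diam_fm_def using assms by (intro Max_ge) auto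
qed

text \<open>In general the subtracted power and the \<open>q powr (- L)\<close> inside the height
  are dropped, and what remains of \<open>height (j - 1)\<close> is \<open>q / (q - 1)\<close> times
  the radius \<open>q powr (1 - j) * diam\<close>. For \<open>p = 1\<close> the increment is exactly
  this radius, which is why the factor can then be removed.\<close>

lemma height_increment_le:
  assumes q: "1 < q" and diam: "0 \<le> diam_fm X d" and p: "1 \<le> p" and j: "1 \<le> j" "j \<le> L"
    and \<kappa>: "\<kappa> = q / (q - 1) \<or> p = 1 \<and> \<kappa> = 1"
  shows "height X d q L (j - 1) powr p - height X d q L j powr p
      \<le> diam_fm X d powr p * (\<kappa> powr p * q powr (p - real j * p))"
proof -
  have qj: "(q powr (1 - real j)) powr p = q powr (p - real j * p)"
    by (simp add: powr_powr left_diff_distrib)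
  have nn: "0 \<le> height X d q L (j - 1)" "0 \<le> height X d q L j"
    using j by (auto intro!: height_nonneg[OF q diam])
  show ?thesis using \<kappa>
  proof
    assume \<kappa>: "\<kappa> = q / (q - 1)"
    then have "0 \<le> \<kappa>" using q by simp
    have "q powr (1 - real (j - 1)) = q * q powr (1 - real j)"
      using q j powr_add[of q 1 "1 - real j"] by (simp add: of_nat_diff algebra_simps)
    then have "height X d q L (j - 1) \<le> (q * q powr (1 - real j)) / (q - 1) * diam_fm X d"
      unfolding height_def using q diam by (intro mult_right_mono divide_right_mono) auto
    also have "\<dots> = diam_fm X d * (\<kappa> * q powr (1 - real j))" by (simp add: \<kappa>)
    finally have "height X d q L (j - 1) powr p \<le> (diam_fm X d * (\<kappa> * q powr (1 - real j))) powr p"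
      using nn p by (intro powr_mono2) auto
    also have "\<dots> = diam_fm X d powr p * (\<kappa> powr p * q powr (p - real j * p))"
      using \<open>0 \<le> \<kappa>\<close> diam by (simp add: powr_mult qj)
    finally show ?thesis by (smt (verit) powr_ge_zero)
  next
    assume \<kappa>: "p = 1 \<and> \<kappa> = 1"
    have "height X d q L (j - 1) - height X d q L j = q powr (1 - real j) * diam_fm X d"
      using height_step[OF q, of X d L "j - 1"] j by (simp add: of_nat_diff)
    then show ?thesis using \<kappa> nn diam by simp
  qed
qed

text \<open>\<open>n j\<close> stands for the number of clusters at level \<open>j\<close>. The
  summand at the leaf level \<open>Suc L\<close> produces the \<open>sqrt (card X)\<close> term of
  \<open>A_const\<close>, the others the cover terms. Allowing \<open>l = Suc L\<close> covers
  \<open>l = 1\<close> with \<open>L = 0\<close>.\<close>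

lemma A_const_bound:
  assumes q: "1 < q" and diam: "0 \<le> diam_fm X d" and p: "1 \<le> p" and l: "1 \<le> l" "l \<le> Suc L"
    and \<kappa>: "\<kappa> = q / (q - 1) \<or> p = 1 \<and> \<kappa> = 1"
    and nX: "n (Suc L) = card X"
    and n: "\<And>j. j \<le> L \<Longrightarrow> n j \<le> cover_number X d (q powr (- real j) * diam_fm X d)"
  shows "2 powr (p - 1) * (\<Sum>j=l..Suc L. (height X d q L (j - 1) powr p - height X d q L j powr p) * sqrt (real (n j)))
      \<le> A_const X d \<kappa> q p L l"
proof -
  let ?D = "diam_fm X d powr p"
  let ?c = "\<lambda>j. sqrt (real (cover_number X d (q powr (- real j) * diam_fm X d)))"
  have last: "height X d q L L powr p = ?D * q powr (- real L * p)"
    using height_step[OF q, of X d L L] q diam by (simp add: height_top powr_mult powr_powr)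
  have "(\<Sum>j=l..L. (height X d q L (j - 1) powr p - height X d q L j powr p) * sqrt (real (n j)))
      \<le> (\<Sum>j=l..L. ?D * (\<kappa> powr p * q powr (p - real j * p)) * ?c j)"
    using l n by (intro sum_mono mult_mono height_increment_le[OF q diam p _ _ \<kappa>]) auto
  also have "\<dots> = ?D * (\<kappa> powr p * (\<Sum>j=l..L. q powr (p - real j * p) * ?c j))"
    by (simp add: sum_distrib_left mult.assoc)
  finally have "(\<Sum>j=l..Suc L. (height X d q L (j - 1) powr p - height X d q L j powr p) * sqrt (real (n j)))
      \<le> ?D * (\<kappa> powr p * (\<Sum>j=l..L. q powr (p - real j * p) * ?c j)) + ?D * q powr (- real L * p) * sqrt (real (card X))"
    using l by (simp add: sum.cl_ivl_Suc last height_top nX)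
  then have "2 powr (p - 1) * (\<Sum>j=l..Suc L. (height X d q L (j - 1) powr p - height X d q L j powr p) * sqrt (real (n j)))
      \<le> 2 powr (p - 1) * (?D * (\<kappa> powr p * (\<Sum>j=l..L. q powr (p - real j * p) * ?c j)) + ?D * q powr (- real L * p) * sqrt (real (card X)))"
    by (intro mult_left_mono) auto
  also have "\<dots> = A_const X d \<kappa> q p L l" by (simp add: A_const_def algebra_simps)
  finally show ?thesis .
qed

text \<open>Heights decrease with the level, so the first level with
  \<open>2 * height \<le> C\<close> is the only candidate. This gives the \<open>THE\<close> in
  \<open>E_Poi_gen\<close> its meaning.\<close>

lemma level_exists_unique:
  assumes q: "1 < q" and diam: "0 \<le> diam_fm X d"
    and C: "2 * height X d q L L \<le> C" "C < 2 * height X d q L 0"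
  shows "\<exists>!l. l \<in> {1..L} \<and> 2 * height X d q L l \<le> C \<and> C < 2 * height X d q L (l - 1)"
proof -
  define l where "l = (LEAST k. 2 * height X d q L k \<le> C)"
  have 1: "2 * height X d q L l \<le> C" unfolding l_def by (rule LeastI, rule C(1))
  have 2: "l \<le> L" unfolding l_def by (rule Least_le, rule C(1))
  have 3: "l \<noteq> 0" using 1 C(2) by (intro notI) simp
  have 4: "C < 2 * height X d q L (l - 1)"
    using not_less_Least[of "l - 1" "\<lambda>k. 2 * height X d q L k \<le> C"] 3 unfolding l_def[symmetric] by simp
  have "l' \<le> l''" if "2 * height X d q L l'' \<le> C" "C < 2 * height X d q L (l' - 1)" for l' l''
  proof (rule ccontr)
    assume "\<not> l' \<le> l''"
    then have "height X d q L (l' - 1) \<le> height X d q L l''"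
      by (intro height_antimono[OF q diam]) simp
    with that show False by simp
  qed
  with 1 2 3 4 show ?thesis by (intro ex1I[of _ l]) (auto intro: antisym)
qed

text \<open>The two claims of the theorem differ only in \<open>\<kappa>\<close>, so they are proved
  together. The regime of \<open>C\<close> selects the stopping level: the leaves for small
  \<open>C\<close>, the root for large \<open>C\<close>, and the critical level \<open>l\<close> in
  between.\<close>

lemma poisson_KR_bound:
  fixes X :: "'a set" and d :: "'a \<Rightarrow> 'a \<Rightarrow> real" and \<mu> :: "'a \<Rightarrow> real"
    and t s p C q \<kappa> :: real and L :: nat
  assumes fm: "finite_metric X d" and card: "card X \<ge> 2" and \<mu>: "\<And>x. x \<in> X \<Longrightarrow> 0 \<le> \<mu> x"
    and t: "t > 0" and s: "0 < s" "s \<le> 1" and p: "p \<ge> 1" and C: "C > 0" and q: "q > 1"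
    and \<kappa>: "\<kappa> = q / (q - 1) \<or> p = 1 \<and> \<kappa> = 1"
  shows "(\<integral>\<^sup>+ \<omega>. ennreal (KR X d p C (estimator t s \<omega>) \<mu>) \<partial>measure_pmf (poisson_model X \<mu> t s))
      \<le> ennreal (poi_bound X d \<mu> t s p C q L (E_Poi_gen X d \<kappa> p C q L))"
proof -
  note sum.cl_ivl_Suc [simp del]
  let ?M = "poisson_model X \<mu> t s" and ?H = "height X d q L"
  define R where "R j = q powr (- real j) * diam_fm X d" for j
  have fin: "finite X" and d0: "\<And>x y. x \<in> X \<Longrightarrow> y \<in> X \<Longrightarrow> 0 \<le> d x y"
    using fm unfolding finite_metric_def by blast+
  obtain x0 where x0: "x0 \<in> X" using card by fastforce
  have diam: "0 \<le> diam_fm X d" using d0[OF x0 x0] dist_le_diam[OF fin x0 x0, of d] by simp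
  have R0: "0 \<le> R j" for j using diam by (simp add: R_def)
  have HS: "?H k = R k + ?H (Suc k)" if "k < Suc L" for k unfolding R_def by (rule height_step[OF q])
  obtain F where F_top: "\<And>x. F (Suc L) x = x"
    and nested: "\<And>k x y. k < Suc L \<Longrightarrow> F (Suc k) x = F (Suc k) y \<Longrightarrow> F k x = F k y"
    and cardF: "\<And>k. k < Suc L \<Longrightarrow> card (F k ` X) \<le> cover_number X d (R k)"
    and dF: "\<And>k x y. k \<le> Suc L \<Longrightarrow> x \<in> X \<Longrightarrow> y \<in> X \<Longrightarrow> F k x = F k y \<Longrightarrow> d x y \<le> 2 * ?H k"
    by (rule nested_covers[where R = R, OF fm R0 height_top HS]) (assumption, rule that)
  define I where "I j \<omega> = imbalance X (F j) (estimator t s \<omega>) \<mu>" for j \<omega>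
  define h where "h j = ?H (j - 1) powr p - ?H j powr p" for j
  define c where "c k = C powr p / 2 - 2 powr (p - 1) * ?H k powr p" for k
  \<comment> \<open>The bound on the \<open>p\<close>-th power of the distance, for each outcome,
    when matching stops at level \<open>k\<close>; \<open>c k\<close> is the net price per unit of
    imbalance left there.\<close>
  define W where "W k \<omega> = c k * I k \<omega> + 2 powr (p - 1) * (\<Sum>j=Suc k..Suc L. h j * I j \<omega>)" for k \<omega>
  define \<sigma> where "\<sigma> = mass X \<mu> / (s * t) + (1 - s) / s * (\<Sum>x\<in>X. (\<mu> x)\<^sup>2)"
  let ?n = "\<lambda>j. sqrt (real (card (F j ` X)))"
  have \<sigma>0: "0 \<le> \<sigma>" using \<mu> t s by (auto simp: \<sigma>_def mass_def intro!: add_nonneg_nonneg mult_nonneg_nonneg sum_nonneg divide_nonneg_nonneg)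
  have H0: "0 \<le> ?H k" if "k \<le> Suc L" for k using height_nonneg[OF q diam that] .
  have h0: "0 \<le> h j" if "j \<le> Suc L" for j
    unfolding h_def using p H0[OF that] by (auto intro!: powr_mono2 height_antimono[OF q diam])
  have I0: "0 \<le> I j \<omega>" for j \<omega> unfolding I_def by (rule imbalance_nonneg)
  have I_int: "integrable ?M (I j)" for j
    unfolding I_def by (rule imbalance_integrable[OF fin \<mu> t s])
  have EI: "measure_pmf.expectation ?M (I j) \<le> ?n j * sqrt \<sigma>" for j
    unfolding I_def \<sigma>_def by (rule expected_imbalance_le_sqrt_card[OF fin \<mu> t s])
  have W_int: "integrable ?M (W k)" for k unfolding W_def using I_int by simp
  have KR_le: "KR X d p C (estimator t s \<omega>) \<mu> \<le> W k \<omega> powr (1 / p)" if "k \<le> Suc L" for k \<omega>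
    unfolding W_def c_def h_def I_def
  proof (rule KR_le_multiscale[where F = F and H = ?H and N = "Suc L"])
    show "0 \<le> estimator t s \<omega> x" for x using s t by (simp add: estimator_def)
    show "F i x = F i y" if "i < Suc L" "F (Suc i) x = F (Suc i) y" for i x y
      using that by (rule nested)
    show "d x y \<le> 2 * ?H i" if "i \<le> Suc L" "x \<in> X" "y \<in> X" "F i x = F i y" for i x y
      using that by (rule dF)
  qed (use fin \<mu> d0 H0 p that height_top in auto)
  have W0: "0 \<le> W k \<omega>" if "0 \<le> c k" for k \<omega>
    unfolding W_def using that I0 h0 by (intro add_nonneg_nonneg mult_nonneg_nonneg sum_nonneg) auto
  have jensen: "(\<integral>\<^sup>+ \<omega>. ennreal (KR X d p C (estimator t s \<omega>) \<mu>) \<partial>?M) \<le> ennreal (a powr (1 / p))"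
    if "k \<le> Suc L" "0 \<le> c k" "measure_pmf.expectation ?M (W k) \<le> a" for k a
  proof -
    have "(\<integral>\<^sup>+ \<omega>. ennreal (KR X d p C (estimator t s \<omega>) \<mu>) \<partial>?M) \<le> (\<integral>\<^sup>+ \<omega>. ennreal (W k \<omega> powr (1 / p)) \<partial>?M)"
      using KR_le[OF that(1)] by (intro nn_integral_mono ennreal_leI)
    also have "\<dots> \<le> ennreal (a powr (1 / p))"
      using W0[OF that(2)] that(3) by (intro nn_integral_powr_inverse_le p W_int)
    finally show ?thesis .
  qed
  \<comment> \<open>As \<open>(2 * H k) powr p = 2 * 2 powr (p - 1) * H k powr p\<close>, the net
    price is nonnegative once \<open>2 * H k \<le> C\<close>. Only then may the imbalance at level
    \<open>k\<close> be replaced by its upper bound.\<close>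
  have c0: "0 \<le> c k" if "k \<le> Suc L" "2 * ?H k \<le> C" for k
  proof -
    have "(2 * ?H k) powr p \<le> C powr p" using that H0 p by (intro powr_mono2) auto
    then show ?thesis using H0[OF that(1)] by (simp add: c_def powr_mult powr_diff)
  qed
  have EW: "measure_pmf.expectation ?M (W k)
      \<le> (c k * ?n k + 2 powr (p - 1) * (\<Sum>j=Suc k..Suc L. h j * ?n j)) * sqrt \<sigma>" if "0 \<le> c k" for k
  proof -
    have "measure_pmf.expectation ?M (W k) = c k * measure_pmf.expectation ?M (I k)
        + 2 powr (p - 1) * (\<Sum>j=Suc k..Suc L. h j * measure_pmf.expectation ?M (I j))"
      unfolding W_def using I_int by (simp add: Bochner_Integration.integral_sum)
    also have "\<dots> \<le> c k * (?n k * sqrt \<sigma>) + 2 powr (p - 1) * (\<Sum>j=Suc k..Suc L. h j * (?n j * sqrt \<sigma>))"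
      using that h0 EI by (intro add_mono mult_left_mono sum_mono) auto
    also have "\<dots> = (c k * ?n k + 2 powr (p - 1) * (\<Sum>j=Suc k..Suc L. h j * ?n j)) * sqrt \<sigma>"
      by (simp add: distrib_right sum_distrib_right mult.assoc)
    finally show ?thesis .
  qed
  have A: "2 powr (p - 1) * (\<Sum>j=l..Suc L. h j * ?n j) \<le> A_const X d \<kappa> q p L l" if "1 \<le> l" "l \<le> Suc L" for l
    unfolding h_def
  proof (rule A_const_bound[OF q diam p that \<kappa>])
    show "card (F (Suc L) ` X) = card X" by (simp add: F_top)
  qed (use cardF in \<open>simp add: R_def\<close>)
  have finish: "(\<integral>\<^sup>+ \<omega>. ennreal (KR X d p C (estimator t s \<omega>) \<mu>) \<partial>?M)
      \<le> ennreal (E powr (1 / p) * \<sigma> powr (1 / (2 * p)))"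
    if "k \<le> Suc L" "2 * ?H k \<le> C" and E: "c k * ?n k + 2 powr (p - 1) * (\<Sum>j=Suc k..Suc L. h j * ?n j) \<le> E" for k E
  proof -
    note ck = c0[OF that(1,2)]
    have "0 \<le> c k * ?n k + 2 powr (p - 1) * (\<Sum>j=Suc k..Suc L. h j * ?n j)"
      using ck h0 by (intro add_nonneg_nonneg mult_nonneg_nonneg sum_nonneg) auto
    with E have E0: "0 \<le> E" by simp
    have "measure_pmf.expectation ?M (W k) \<le> E * sqrt \<sigma>"
      using EW[OF ck] mult_right_mono[OF E, of "sqrt \<sigma>"] \<sigma>0 by simp
    from jensen[OF that(1) ck this] show ?thesis
      using E0 \<sigma>0 by (simp add: powr_mult powr_half_sqrt[symmetric] powr_powr)
  qed
  show ?thesis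
  proof (cases "C \<le> max (2 * ?H L) (min_dist X d)")
    case True
    \<comment> \<open>Stopping at the leaves matches each point only with itself: the sum over
      levels is empty and half the l1 distance is paid at price \<open>C powr p\<close>.\<close>
    have cL: "c (Suc L) = C powr p / 2" by (simp add: c_def height_top)
    have WL: "W (Suc L) = (\<lambda>\<omega>. C powr p / 2 * I (Suc L) \<omega>)" by (simp add: W_def cL fun_eq_iff)
    define T where "T = 2 * (1 - s) * mass X \<mu> + s / sqrt t * (\<Sum>x\<in>X. sqrt (\<mu> x))"
    have T0: "0 \<le> T" using \<mu> t s
      by (auto simp: T_def mass_def intro!: add_nonneg_nonneg mult_nonneg_nonneg sum_nonneg divide_nonneg_nonneg)
    have "measure_pmf.expectation ?M (I (Suc L)) \<le> T"
      unfolding I_def T_def by (rule expected_total_variation_le[OF fin \<mu> t s F_top])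
    then have "measure_pmf.expectation ?M (W (Suc L)) \<le> C powr p / 2 * T"
      using I_int unfolding WL by (simp add: mult_left_mono)
    from jensen[OF order_refl _ this] have "(\<integral>\<^sup>+ \<omega>. ennreal (KR X d p C (estimator t s \<omega>) \<mu>) \<partial>?M)
        \<le> ennreal ((C powr p / 2 * T) powr (1 / p))" by (simp add: cL)
    also have "(C powr p / 2 * T) powr (1 / p) = poi_bound X d \<mu> t s p C q L (E_Poi_gen X d \<kappa> p C q L)"
      unfolding poi_bound_def E_Poi_gen_def T_def[symmetric] using True T0 by (simp add: powr_mult[symmetric])
    finally show ?thesis .
  next
    case notsmall: False
    then have CL: "2 * ?H L \<le> C" by simp
    have bound: "poi_bound X d \<mu> t s p C q L E = E powr (1 / p) * \<sigma> powr (1 / (2 * p))" for E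
      using notsmall by (simp add: poi_bound_def \<sigma>_def)
    show ?thesis
    proof (cases "C \<ge> 2 * ?H 0")
      case True
      \<comment> \<open>The level-0 radius is the diameter, so one point covers \<open>X\<close>,
        there is at most one cluster, and \<open>c 0\<close> enters without a root factor.\<close>
      have "cover_number X d (R 0) \<le> card {x0}"
        using x0 dist_le_diam[OF fin _ x0, of _ d] q by (intro cover_number_le[OF fm]) (auto simp: R_def)
      then have "?n 0 \<le> 1" using cardF[of 0] by simp
      then have "c 0 * ?n 0 \<le> c 0" using c0[of 0] True by (simp add: mult_left_le)
      then have "c 0 * ?n 0 + 2 powr (p - 1) * (\<Sum>j=Suc 0..Suc L. h j * ?n j) \<le> c 0 + A_const X d \<kappa> q p L 1"
        using A[of 1] by simp
      moreover have "E_Poi_gen X d \<kappa> p C q L = c 0 + A_const X d \<kappa> q p L 1"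
        using True notsmall q by (simp add: E_Poi_gen_def c_def height_def)
      ultimately show ?thesis
        using finish[of 0] True by (simp add: bound)
    next
      case False
      define l where "l = (THE l. l \<in> {1..L} \<and> 2 * ?H l \<le> C \<and> C < 2 * ?H (l - 1))"
      have l: "1 \<le> l" "l \<le> L" "2 * ?H l \<le> C" "C < 2 * ?H (l - 1)"
        using theI'[OF level_exists_unique[OF q diam CL], folded l_def] False by auto
      \<comment> \<open>The upper condition on \<open>C\<close> bounds the net price at level
        \<open>l\<close> by the weight of the increment from \<open>l\<close> to
        \<open>l - 1\<close>. The stopping term is thus absorbed as the summand
        \<open>j = l\<close>, and the sum in \<open>A_const\<close> starts at
        \<open>l\<close>.\<close>
      have "C powr p \<le> (2 * ?H (l - 1)) powr p" using l C p by (intro powr_mono2) auto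
      then have "c l \<le> 2 powr (p - 1) * h l"
        using H0[of "l - 1"] l by (simp add: c_def h_def powr_mult powr_diff right_diff_distrib)
      then have "c l * ?n l \<le> 2 powr (p - 1) * h l * ?n l" by (intro mult_right_mono) auto
      moreover have "{l..Suc L} = insert l {Suc l..Suc L}" using l by auto
      ultimately have "c l * ?n l + 2 powr (p - 1) * (\<Sum>j=Suc l..Suc L. h j * ?n j) \<le> A_const X d \<kappa> q p L l"
        using A[of l] l by (simp add: distrib_left mult.assoc)
      moreover have "E_Poi_gen X d \<kappa> p C q L = A_const X d \<kappa> q p L l"
        using False notsmall by (simp add: E_Poi_gen_def l_def)
      ultimately show ?thesis
        using finish[of l] l by (simp add: bound)
    qed
  qed
qed

theorem theorem2p2:
  fixes X :: "'a set" and d :: "'a \<Rightarrow> 'a \<Rightarrow> real" and \<mu> :: "'a \<Rightarrow> real"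
    and t s p C q :: real and L :: nat
  assumes "finite_metric X d" and "card X \<ge> 2"
    and "\<forall>x\<in>X. \<mu> x \<ge> 0"
    and "t > 0" and "0 < s" and "s \<le> 1"
    and "p \<ge> 1" and "C > 0" and "q > 1"
  shows "(\<integral>\<^sup>+ \<omega>. ennreal (KR X d p C (estimator t s \<omega>) \<mu>) \<partial>measure_pmf (poisson_model X \<mu> t s))
           \<le> ennreal (poi_bound X d \<mu> t s p C q L (E_Poi X d p C q L))
       \<and> (p = 1 \<longrightarrow>
         (\<integral>\<^sup>+ \<omega>. ennreal (KR X d p C (estimator t s \<omega>) \<mu>) \<partial>measure_pmf (poisson_model X \<mu> t s))
           \<le> ennreal (poi_bound X d \<mu> t s p C q L (E_Poi_gen X d 1 p C q L)))"
  using poisson_KR_bound[OF assms(1,2) _ assms(4-9)] assms(3) unfolding E_Poi_def by blast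

end
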